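(* Let $\alpha\in(0,1]$, $\tau>0$, $d\in\mathbb{N}$. Let $A(\cdot)=(a_{ij}(\cdot))$ and $B(\cdot)=(b_{ij}(\cdot)):[0,+\infty)\to\mathbb{R}^{d\times d}$ be continuous matrix-valued functions and let $q:[0,+\infty)\to[0,\tau]$ be continuous. For $\varphi\in C([-\tau,0];\mathbb{R}^d)$ let $\Phi(\cdot,\varphi)$ denote the unique global solution on $[-\tau,+\infty)$ of $${}^{C}D^{\alpha}_{0^+}x(t)=A(t)x(t)+B(t)x(t-q(t)),\quad t>0,\qquad x(t)=\varphi(t),\quad t\in[-\tau,0].$$ Assume that for each $t\ge 0$ the matrix $A(t)$ is Metzler and the matrix $B(t)$ is nonnegative. In addition, assume there exist $a_0>0$ and $p\in(0,1)$ such that, for all $t\ge 0$, $$\max_{j\in\{1,\dots,d\}}\sum_{i=1}^d a_{ij}(t)\le -a_0\quad\text{and}\quad \frac{\max_{j\in\{1,\dots,d\}}\sum_{i=1}^d b_{ij}(t)}{\max_{j\in\{1,\dots,d\}}\sum_{i=1}^d a_{ij}(t)}\ge -p.$$ Then, for any $\varphi\in C([-\tau,0];\mathbb{R}^d)$, the solution $\Phi(\cdot,\varphi)$ converges to the origin, that is, $\lim_{t\to\infty}\Phi(t,\varphi)=0$. Furthermore, there is a constant $\lambda>0$ such that $$\|\Phi(t,\varphi)\|\le\Big(\sup_{s\in[-\tau,0]}\|\varphi(s)\|\Big)E_{\alpha}(-\lambda t^{\alpha})\quad\text{for all } t\ge 0.$$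
   Context: The norm on $\mathbb{R}^d$ is $\|x\|=\sum_{i=1}^d|x_i|$. A matrix is Metzler if its off-diagonal entries are nonnegative; it is nonnegative if all its entries are nonnegative. $C(J;\mathbb{R}^d)$ is the set of continuous functions from $J$ to $\mathbb{R}^d$. The Riemann--Liouville fractional integral of order $\beta>0$ is $I^{\beta}_{0^+}x(t)=\frac{1}{\Gamma(\beta)}\int_0^t(t-u)^{\beta-1}x(u)\,du$ (with $I^0_{0^+}$ the identity). The Caputo fractional derivative of order $\alpha\in(0,1]$ is ${}^{C}D^{\alpha}_{0^+}x(t)=\frac{d}{dt}I^{1-\alpha}_{0^+}(x(t)-x(0))$ for $t>0$, taken componentwise for vector-valued functions. The Mittag-Leffler function is $E_{\alpha}(x)=\sum_{k=0}^{\infty}\frac{x^k}{\Gamma(\alpha k+1)}$. A solution is a continuous function on $[-\tau,+\infty)$ satisfying the equation for $t>0$ and the initial condition on $[-\tau,0]$; it is known that, under the stated continuity assumptions, the initial value problem has a unique global solution. *)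

theory Defs
  imports "HOL-Analysis.Analysis"
begin

text \<open>The sum norm on \<open>real ^ 'd\<close>; the library's \<open>norm\<close> on this type is the Euclidean one.\<close>

definition norm1 :: "real ^ 'd \<Rightarrow> real" where
  "norm1 x = (\<Sum>i\<in>UNIV. \<bar>x $ i\<bar>)"

definition metzler :: "real ^ 'd ^ 'd \<Rightarrow> bool" where
  "metzler M \<longleftrightarrow> (\<forall>i j. i \<noteq> j \<longrightarrow> 0 \<le> M $ i $ j)"

definition nonneg_matrix :: "real ^ 'd ^ 'd \<Rightarrow> bool" where
  "nonneg_matrix M \<longleftrightarrow> (\<forall>i j. 0 \<le> M $ i $ j)"

text \<open>In \<open>M $ i $ j\<close> the row index is \<open>i\<close>, so this is the largest column sum.\<close>

definition max_col_sum :: "real ^ 'd ^ 'd \<Rightarrow> real" where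
  "max_col_sum M = (MAX j. \<Sum>i\<in>UNIV. M $ i $ j)"

text \<open>The value at \<open>u = t\<close>, where \<open>0 powr (\<beta> - 1) = 0\<close>, does not affect the integral.
  Integrals and derivatives in \<open>real ^ 'd\<close> are componentwise.\<close>

definition RL_integral :: "real \<Rightarrow> (real \<Rightarrow> real ^ 'd) \<Rightarrow> real \<Rightarrow> real ^ 'd" where
  "RL_integral \<beta> x t =
     (if \<beta> = 0 then x t
      else (1 / Gamma \<beta>) *\<^sub>R integral {0..t} (\<lambda>u. ((t - u) powr (\<beta> - 1)) *\<^sub>R x u))"

text \<open>A relation rather than a function, so that asserting a value of the Caputo derivative
  includes its existence.\<close>

definition has_caputo_derivative ::
    "real \<Rightarrow> (real \<Rightarrow> real ^ 'd) \<Rightarrow> real ^ 'd \<Rightarrow> real \<Rightarrow> bool" where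
  "has_caputo_derivative \<alpha> x v t \<longleftrightarrow>
     ((RL_integral (1 - \<alpha>) (\<lambda>u. x u - x 0)) has_vector_derivative v) (at t)"

definition mittag_leffler :: "real \<Rightarrow> real \<Rightarrow> real" where
  "mittag_leffler \<alpha> x = (\<Sum>k. x ^ k / Gamma (\<alpha> * real k + 1))"

text \<open>Functions on \<open>[-\<tau>, \<infinity>)\<close> are total functions on \<open>real\<close>, of which only the values on
  \<open>{-\<tau>..}\<close> matter.\<close>

definition is_solution ::
    "real \<Rightarrow> real \<Rightarrow> (real \<Rightarrow> real ^ 'd ^ 'd) \<Rightarrow> (real \<Rightarrow> real ^ 'd ^ 'd) \<Rightarrow> (real \<Rightarrow> real)
      \<Rightarrow> (real \<Rightarrow> real ^ 'd) \<Rightarrow> (real \<Rightarrow> real ^ 'd) \<Rightarrow> bool" where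
  "is_solution \<alpha> \<tau> A B q \<phi> x \<longleftrightarrow>
     continuous_on {-\<tau>..} x \<and>
     (\<forall>t>0. has_caputo_derivative \<alpha> x (A t *v x t + B t *v x (t - q t)) t) \<and>
     (\<forall>t\<in>{-\<tau>..0}. x t = \<phi> t)"

end

theory Submission
  imports Defs
begin

text \<open>
  Compare \<open>norm1 (\<Phi> t)\<close> with \<open>Y t = L * r t\<close>, where \<open>r t = E\<^sub>\<alpha> (- \<mu> t\<^sup>\<alpha>)\<close> and \<open>L\<close> exceeds the
  supremum of the initial data. At a first touching time \<open>t1\<close> fix the signs \<open>\<sigma>\<close> of \<open>\<Phi> t1\<close>. The scalar
  function \<open>w = Y - \<sigma> \<bullet> \<Phi>\<close> vanishes at \<open>t1\<close>, but for large \<open>K\<close> the column sum conditions show that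
  \<open>w = w 0 + I\<^sup>\<alpha> (f - K w)\<close> on \<open>{0..t1}\<close> with \<open>w 0 > 0\<close> and \<open>f \<ge> 0\<close>, which forces \<open>w t1 > 0\<close>.

  This positivity rests on the monotonicity of \<open>E\<^sub>\<alpha> (- K t\<^sup>\<alpha>)\<close>, which is obtained from its Volterra
  equation and the log-convexity of the kernel \<open>t\<^sup>\<alpha>\<^sup>-\<^sup>1\<close> by a first-zero argument. The Volterra equation
  \<open>r = 1 - \<mu> I\<^sup>\<alpha> r\<close> also shows
  \<open>r s (1 - \<mu> (t - s)\<^sup>\<alpha> / \<Gamma>(\<alpha> + 1)) \<le> r t\<close> for \<open>s \<le> t\<close>, so for small \<open>\<mu>\<close> the delay costs a factor
  that is absorbed by \<open>p < 1\<close>.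
\<close>

section \<open>Fractional integrals\<close>

text \<open>A Caputo derivative at the touching time depends on the whole past, and
  \<open>norm1\<close> of a solution need not be differentiable, so no sign of a derivative at
  \<open>t1\<close> can be exploited; all equations are used in integral form. With frozen signs,
  \<open>\<sigma> \<bullet> \<Phi>\<close> is linear in the solution, never exceeds
  \<open>norm1 \<Phi>\<close> and agrees with it at \<open>t1\<close>. The signs are correct only at
  \<open>t1\<close>, yet the estimate \<open>f \<ge> 0\<close> is required at every earlier time.
  Adding \<open>K\<close> times the identity gives \<open>A\<close> nonnegative diagonal entries on
  \<open>{0..t1}\<close>, so that all entries can be estimated in absolute value. \<open>A\<close>
  is not assumed bounded, hence \<open>K\<close> depends on \<open>t1\<close>; this is harmless
  because \<open>K\<close> disappears from the conclusion, whereas \<open>\<mu>\<close> depends only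
  on \<open>\<alpha>\<close>, \<open>\<tau>\<close>, \<open>a\<^sub>0\<close> and \<open>p\<close>.
  The strict gap between \<open>L\<close> and the initial data provides \<open>w 0 > 0\<close> and
  is closed at the end by a limit.\<close>

lemma has_integral_power_kernel:
  fixes \<beta> a b t :: real
  assumes "0 < \<beta>" "a \<le> b" "b \<le> t"
  shows "((\<lambda>u. (t - u) powr (\<beta> - 1)) has_integral ((t - a) powr \<beta> - (t - b) powr \<beta>) / \<beta>) {a..b}"
proof -
  have "((\<lambda>u. (t - u) powr (\<beta> - 1)) has_integral
      (- ((t - b) powr \<beta> / \<beta>)) - (- ((t - a) powr \<beta> / \<beta>))) {a..b}"
  proof (rule fundamental_theorem_of_calculus_interior)
    show "continuous_on {a..b} (\<lambda>u. - ((t - u) powr \<beta> / \<beta>))"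
      using assms by (intro continuous_intros continuous_on_powr') auto
    fix x assume "x \<in> {a<..<b}"
    then show "((\<lambda>u. - ((t - u) powr \<beta> / \<beta>)) has_vector_derivative (t - x) powr (\<beta> - 1)) (at x)"
      unfolding has_real_derivative_iff_has_vector_derivative[symmetric]
      using assms by (auto intro!: derivative_eq_intros)
  qed (use assms in auto)
  moreover have "(- ((t - b) powr \<beta> / \<beta>)) - (- ((t - a) powr \<beta> / \<beta>)) = ((t - a) powr \<beta> - (t - b) powr \<beta>) / \<beta>"
    by (simp add: diff_divide_distrib)
  ultimately show ?thesis by metis
qed

section \<open>Integrability of singular kernels and interchange of convolution integrals\<close>

text \<open>\<open>RL_integral\<close> is a gauge integral, while the interchange of integrals below
  is carried out with Bochner integrals over \<open>lborel\<close>. Borel measurability of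
  \<open>f\<close> permits the passage from the completed measure to \<open>lborel\<close>.\<close>

lemma set_integrable_lborel_if_absolutely_integrable:
  fixes f :: "real \<Rightarrow> real"
  assumes "f absolutely_integrable_on S" "S \<in> sets borel"
    and "f \<in> borel_measurable borel"
  shows "set_integrable lborel S f"
  using assms unfolding set_integrable_def
  by (subst integrable_completion[symmetric]) auto

lemma set_integrable_power_kernel:
  fixes \<beta> t :: real
  assumes "0 < \<beta>"
  shows "set_integrable lborel {0..t} (\<lambda>u. (t - u) powr (\<beta> - 1))"
proof (cases "0 \<le> t")
  case True
  have "(\<lambda>u. (t - u) powr (\<beta> - 1)) absolutely_integrable_on {0..t}"
    using has_integral_power_kernel[OF assms True order_refl]
    by (intro nonnegative_absolutely_integrable_1) (auto simp: integrable_on_def)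
  then show ?thesis
    by (rule set_integrable_lborel_if_absolutely_integrable) auto
qed (simp add: set_integrable_def)

lemma set_integrable_power:
  fixes \<beta> t :: real
  assumes "0 < \<beta>"
  shows "set_integrable lborel {0..t} (\<lambda>u. u powr (\<beta> - 1))"
proof -
  have "set_integrable lborel {0..t} (\<lambda>u. (t - u) powr (\<beta> - 1))"
    by (rule set_integrable_power_kernel[OF assms])
  then have "integrable lborel (\<lambda>u. indicator {0..t} (t + (-1) * u) *\<^sub>R (t - (t + (-1) * u)) powr (\<beta> - 1))"
    unfolding set_integrable_def
    by (rule lborel_integrable_real_affine[where c="-1" and t=t]) simp
  moreover have "indicator {0..t} (t + (-1) * u) = (indicator {0..t} u :: real)" for u
    by (auto simp: indicator_def)
  ultimately show ?thesis by (simp add: set_integrable_def)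
qed

lemma set_integrable_mult_continuous:
  fixes k f :: "real \<Rightarrow> real"
  assumes k: "set_integrable lborel {a..b} k" and f: "continuous_on {a..b} f"
  shows "set_integrable lborel {a..b} (\<lambda>u. k u * f u)"
proof -
  have "bounded (f ` {a..b})"
    by (intro compact_imp_bounded compact_continuous_image f) auto
  then obtain M where M: "\<And>x. x \<in> {a..b} \<Longrightarrow> norm (f x) \<le> M"
    unfolding bounded_iff by blast
  have m: "(\<lambda>u. indicator {a..b} u *\<^sub>R f u) \<in> borel_measurable borel"
    by (rule borel_measurable_continuous_on_indicator) (auto simp: f)
  have mk: "(\<lambda>u. indicator {a..b} u *\<^sub>R k u) \<in> borel_measurable borel"
    using k unfolding set_integrable_def by (auto dest: borel_measurable_integrable)
  have "integrable lborel (\<lambda>u. (indicator {a..b} u *\<^sub>R k u) * (indicator {a..b} u *\<^sub>R f u))"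
  proof (rule Bochner_Integration.integrable_bound)
    show "integrable lborel (\<lambda>u. M * (indicator {a..b} u *\<^sub>R k u))"
      using k unfolding set_integrable_def by (rule integrable_mult_right)
    show "AE u in lborel. norm ((indicator {a..b} u *\<^sub>R k u) * (indicator {a..b} u *\<^sub>R f u))
        \<le> norm (M * (indicator {a..b} u *\<^sub>R k u))"
    proof (rule AE_I2)
      fix u
      have "\<bar>k u\<bar> * \<bar>f u\<bar> \<le> \<bar>k u\<bar> * \<bar>M\<bar>" if "u \<in> {a..b}"
        using M[OF that] by (intro mult_left_mono) auto
      then show "norm ((indicator {a..b} u *\<^sub>R k u) * (indicator {a..b} u *\<^sub>R f u))
          \<le> norm (M * (indicator {a..b} u *\<^sub>R k u))"
        by (auto simp: indicator_def abs_mult mult.commute)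
    qed
  qed (use m mk in measurable)
  moreover have "(\<lambda>u. (indicator {a..b} u *\<^sub>R k u) * (indicator {a..b} u *\<^sub>R f u))
      = (\<lambda>u. indicator {a..b} u *\<^sub>R (k u * f u))"
    by (auto simp: indicator_def)
  ultimately show ?thesis
    unfolding set_integrable_def by simp
qed

lemma kernel_mult_integrable:
  fixes f :: "real \<Rightarrow> real"
  assumes "0 < \<beta>" and "continuous_on {a..b} f" and "0 \<le> a" "b \<le> t"
  shows "(\<lambda>u. (t - u) powr (\<beta> - 1) * f u) integrable_on {a..b}"
proof (rule set_borel_integral_eq_integral, rule set_integrable_mult_continuous)
  show "set_integrable lborel {a..b} (\<lambda>u. (t - u) powr (\<beta> - 1))"
    by (rule set_integrable_subset[OF set_integrable_power_kernel[OF assms(1), of t]])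
       (use assms in auto)
qed (use assms in auto)

text \<open>Fubini on the triangle \<open>0 \<le> u \<le> s \<le> t\<close>, followed by the
  substitution \<open>s = t - v\<close>. The kernels \<open>a\<close> and \<open>b\<close> may be
  singular, so they are only assumed integrable; the bounded factor \<open>c\<close> makes the
  double integral absolutely convergent.\<close>

lemma convolution_swap:
  fixes a b c :: "real \<Rightarrow> real"
  assumes a: "set_integrable lborel {0..t} a"
    and b: "set_integrable lborel {0..t} b"
    and c: "continuous_on {0..t} c"
    and inner: "\<And>x. 0 < x \<Longrightarrow> x \<le> t \<Longrightarrow> set_integrable lborel {0..x} (\<lambda>v. b (x - v) * a v)"
    and b': "\<And>x. 0 \<le> x \<Longrightarrow> x \<le> t \<Longrightarrow> set_integrable lborel {0..x} (\<lambda>u. b (x - u))"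
    and outer: "set_integrable lborel {0..t} (\<lambda>s. a (t - s) * integral {0..s} (\<lambda>u. b (s - u) * c u))"
    and outer': "set_integrable lborel {0..t} (\<lambda>u. integral {0..t - u} (\<lambda>v. b (t - u - v) * a v) * c u)"
    and "0 \<le> t"
  shows "integral {0..t} (\<lambda>s. a (t - s) * integral {0..s} (\<lambda>u. b (s - u) * c u))
       = integral {0..t} (\<lambda>u. integral {0..t - u} (\<lambda>v. b (t - u - v) * a v) * c u)"
proof -
  define A where "A u = indicator {0..t} u * a u" for u
  define B where "B u = indicator {0..t} u * b u" for u
  define C where "C u = indicator {0..t} u * c u" for u
  have iA: "integrable lborel A" and iB: "integrable lborel B"
    using a b by (auto simp: A_def[abs_def] B_def[abs_def] set_integrable_def)
  have mC: "C \<in> borel_measurable borel"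
    using borel_measurable_continuous_on_indicator[of "{0..t}" c] c by (auto simp: C_def[abs_def])
  have mA: "A \<in> borel_measurable borel" and mB: "B \<in> borel_measurable borel"
    using iA iB by (auto dest: borel_measurable_integrable)
  have "bounded (c ` {0..t})"
    by (intro compact_imp_bounded compact_continuous_image c) auto
  then obtain M0 where M0: "\<And>x. x \<in> {0..t} \<Longrightarrow> norm (c x) \<le> M0"
    unfolding bounded_iff by blast
  define M where "M = max M0 0"
  have M: "\<bar>C u\<bar> \<le> M" for u
    using M0[of u] by (auto simp: C_def M_def indicator_def)
  \<comment> \<open>The zero extensions encode the triangle: \<open>A\<close> forces
    \<open>0 \<le> s \<le> t\<close>, \<open>C\<close> forces \<open>0 \<le> u\<close>, and
    \<open>B\<close> forces \<open>u \<le> s\<close>. The double integral of the absolute value of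
    \<open>H\<close> is at most \<open>M\<close> times the product of the L1 norms of
    \<open>A\<close> and \<open>B\<close>.\<close>
  define H where "H = (\<lambda>(s, u). A (t - s) * B (s - u) * C u)"
  have mH: "H \<in> borel_measurable (lborel \<Otimes>\<^sub>M lborel)"
    unfolding H_def using mA mB mC by measurable
  have iBs: "integrable lborel (\<lambda>u. B (s - u))" for s
    using lborel_integrable_real_affine[OF iB, of "-1" s] by simp
  have iAt: "integrable lborel (\<lambda>s. A (t - s))"
    using lborel_integrable_real_affine[OF iA, of "-1" t] by simp
  have Bn: "(LINT u|lborel. \<bar>B (s - u)\<bar>) = (LINT u|lborel. \<bar>B u\<bar>)" for s
    using lborel_integral_real_affine[of "-1" "\<lambda>u. \<bar>B u\<bar>" s] by simp
  have iH: "integrable lborel (\<lambda>u. H (s, u))" for s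
  proof (rule Bochner_Integration.integrable_bound)
    show "integrable lborel (\<lambda>u. \<bar>A (t - s)\<bar> * M * B (s - u))"
      by (intro integrable_mult_right iBs)
    show "AE u in lborel. norm (H (s, u)) \<le> norm (\<bar>A (t - s)\<bar> * M * B (s - u))"
    proof (rule AE_I2)
      fix u
      have "\<bar>A (t - s)\<bar> * \<bar>B (s - u)\<bar> * \<bar>C u\<bar> \<le> \<bar>A (t - s)\<bar> * \<bar>B (s - u)\<bar> * M"
        using M by (intro mult_left_mono) auto
      then show "norm (H (s, u)) \<le> norm (\<bar>A (t - s)\<bar> * M * B (s - u))"
        by (simp add: H_def abs_mult M_def ac_simps)
    qed
  qed (use mH in measurable)
  have intH: "integrable (lborel \<Otimes>\<^sub>M lborel) H"
  proof (rule lborel_pair.Fubini_integrable[OF mH])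
    show "integrable lborel (\<lambda>s. LINT u|lborel. norm (H (s, u)))"
    proof (rule Bochner_Integration.integrable_bound)
      show "integrable lborel (\<lambda>s. (M * (LINT u|lborel. \<bar>B u\<bar>)) * \<bar>A (t - s)\<bar>)"
        by (intro integrable_mult_right integrable_abs iAt)
      show "(\<lambda>s. LINT u|lborel. norm (H (s, u))) \<in> borel_measurable lborel"
        using mH by measurable
      show "AE s in lborel. norm (LINT u|lborel. norm (H (s, u)))
          \<le> norm ((M * (LINT u|lborel. \<bar>B u\<bar>)) * \<bar>A (t - s)\<bar>)"
      proof (rule AE_I2)
        fix s
        have "(LINT u|lborel. norm (H (s, u))) \<le> (LINT u|lborel. \<bar>A (t - s)\<bar> * M * \<bar>B (s - u)\<bar>)"
        proof (rule integral_mono)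
          show "integrable lborel (\<lambda>u. norm (H (s, u)))"
            by (intro integrable_norm iH)
          show "integrable lborel (\<lambda>u. \<bar>A (t - s)\<bar> * M * \<bar>B (s - u)\<bar>)"
            by (intro integrable_mult_right integrable_abs iBs)
          fix u
          have "\<bar>A (t - s)\<bar> * \<bar>B (s - u)\<bar> * \<bar>C u\<bar> \<le> \<bar>A (t - s)\<bar> * \<bar>B (s - u)\<bar> * M"
            using M by (intro mult_left_mono) auto
          then show "norm (H (s, u)) \<le> \<bar>A (t - s)\<bar> * M * \<bar>B (s - u)\<bar>"
            by (simp add: H_def abs_mult M_def ac_simps)
        qed
        also have "\<dots> = (M * (LINT u|lborel. \<bar>B u\<bar>)) * \<bar>A (t - s)\<bar>"
          by (simp add: Bn)
        finally show "norm (LINT u|lborel. norm (H (s, u)))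
          \<le> norm ((M * (LINT u|lborel. \<bar>B u\<bar>)) * \<bar>A (t - s)\<bar>)"
          by (simp add: M_def)
      qed
    qed
    show "AE s in lborel. integrable lborel (\<lambda>u. H (s, u))"
      by (simp add: iH)
  qed
  have inner1: "(LINT u|lborel. H (s, u))
      = indicator {0..t} s * (a (t - s) * integral {0..s} (\<lambda>u. b (s - u) * c u))" for s
  proof (cases "s \<in> {0..t}")
    case False
    then show ?thesis by (auto simp: H_def A_def indicator_def)
  next
    case True
    have "(LINT u|lborel. H (s, u)) = (LINT u|lborel. a (t - s) * (indicator {0..s} u *\<^sub>R (b (s - u) * c u)))"
      using True by (intro Bochner_Integration.integral_cong)
        (auto simp: H_def A_def B_def C_def indicator_def)
    also have "\<dots> = a (t - s) * (LINT u:{0..s}|lborel. b (s - u) * c u)"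
      by (simp add: set_lebesgue_integral_def)
    also have "(LINT u:{0..s}|lborel. b (s - u) * c u) = integral {0..s} (\<lambda>u. b (s - u) * c u)"
      using True by (intro set_borel_integral_eq_integral set_integrable_mult_continuous b'
          continuous_on_subset[OF c]) auto
    finally show ?thesis using True by simp
  qed
  have inner2: "(LINT s|lborel. H (s, u))
      = indicator {0..t} u * (integral {0..t - u} (\<lambda>v. b (t - u - v) * a v) * c u)" if "u \<noteq> t" for u
  proof (cases "u \<in> {0..t}")
    case False
    then show ?thesis by (auto simp: H_def C_def indicator_def)
  next
    case True
    have "(LINT s|lborel. H (s, u)) = (LINT v|lborel. H (t - v, u))"
      using lborel_integral_real_affine[of "-1" "\<lambda>s. H (s, u)" t] by simp
    also have "\<dots> = (LINT v|lborel. c u * (indicator {0..t - u} v *\<^sub>R (b (t - u - v) * a v)))"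
      using True by (intro Bochner_Integration.integral_cong)
        (auto simp: H_def A_def B_def C_def indicator_def algebra_simps)
    also have "\<dots> = c u * (LINT v:{0..t - u}|lborel. b (t - u - v) * a v)"
      by (simp add: set_lebesgue_integral_def)
    also have "(LINT v:{0..t - u}|lborel. b (t - u - v) * a v) = integral {0..t - u} (\<lambda>v. b (t - u - v) * a v)"
      using True that by (intro set_borel_integral_eq_integral inner) auto
    finally show ?thesis using True by simp
  qed
  have "integral {0..t} (\<lambda>s. a (t - s) * integral {0..s} (\<lambda>u. b (s - u) * c u))
     = (LINT s|lborel. (LINT u|lborel. H (s, u)))"
    unfolding inner1 using set_borel_integral_eq_integral(2)[OF outer]
    by (simp add: set_lebesgue_integral_def)
  also have "\<dots> = (LINT u|lborel. (LINT s|lborel. H (s, u)))"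
    using lborel_pair.Fubini_integral[of "\<lambda>s u. H (s, u)"] intH by simp
  also have "\<dots> = (LINT u|lborel. indicator {0..t} u * (integral {0..t - u} (\<lambda>v. b (t - u - v) * a v) * c u))"
  proof (rule integral_cong_AE)
    show "(\<lambda>u. LINT s|lborel. H (s, u)) \<in> borel_measurable lborel"
      using mH by measurable
    show "(\<lambda>u. indicator {0..t} u * (integral {0..t - u} (\<lambda>v. b (t - u - v) * a v) * c u)) \<in> borel_measurable lborel"
      using outer' unfolding set_integrable_def by (auto dest: borel_measurable_integrable)
    show "AE u in lborel. (LINT s|lborel. H (s, u)) = indicator {0..t} u * (integral {0..t - u} (\<lambda>v. b (t - u - v) * a v) * c u)"
      using AE_lborel_singleton[of t] by eventually_elim (rule inner2)
  qed
  also have "\<dots> = integral {0..t} (\<lambda>u. integral {0..t - u} (\<lambda>v. b (t - u - v) * a v) * c u)"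
    using set_borel_integral_eq_integral(2)[OF outer'] by (simp add: set_lebesgue_integral_def)
  finally show ?thesis .
qed

text \<open>The Beta integral over \<open>{0..1}\<close> rescaled to \<open>{0..x}\<close>: the
  convolution of two power kernels is again a power kernel.\<close>

lemma has_integral_beta_kernel:
  fixes a b x :: real
  assumes "0 < a" "0 < b" "0 < x"
  shows "((\<lambda>v. (x - v) powr (b - 1) * v powr (a - 1)) has_integral Beta a b * x powr (a + b - 1)) {0..x}"
proof -
  have B: "((\<lambda>t. t powr (a - 1) * (1 - t) powr (b - 1)) has_integral Beta a b) (cbox 0 1)"
    using has_integral_Beta_real[OF assms(1,2)] by simp
  have "((\<lambda>v. (1 / x * v + 0) powr (a - 1) * (1 - (1 / x * v + 0)) powr (b - 1)) has_integral Beta a b * x) {0..x}"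
    using has_integral_affinity'[OF B, of "1 / x" 0] assms by (simp add: mult.commute)
  then have "((\<lambda>v. x powr (a + b - 2) * ((1 / x * v + 0) powr (a - 1) * (1 - (1 / x * v + 0)) powr (b - 1)))
      has_integral x powr (a + b - 2) * (Beta a b * x)) {0..x}"
    by (rule has_integral_mult_right)
  moreover have "x powr (a + b - 2) * (Beta a b * x) = Beta a b * x powr (a + b - 1)"
    using assms powr_mult_base[of x "a + b - 2"] by (simp add: mult.left_commute mult.commute)
  moreover have "x powr (a + b - 2) * ((1 / x * v + 0) powr (a - 1) * (1 - (1 / x * v + 0)) powr (b - 1))
      = (x - v) powr (b - 1) * v powr (a - 1)" if "v \<in> {0..x}" for v
  proof -
    have "1 - v / x = (x - v) / x"
      using assms by (simp add: diff_divide_distrib)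
    moreover have "x powr (a + b - 2) = x powr (a - 1) * x powr (b - 1)"
      by (simp add: powr_add[symmetric])
    ultimately show ?thesis
      using that assms by (simp add: powr_divide)
  qed
  ultimately show ?thesis
    by (metis (no_types, lifting) has_integral_cong)
qed

section \<open>The scalar fractional integral\<close>

text \<open>Scalar counterpart of \<open>RL_integral\<close> for positive order. At order 0 it is
  not the identity: \<open>Gamma 0 = 0\<close> makes the quotient 0. The case
  \<open>\<alpha> = 1\<close> of the Caputo derivative is therefore treated separately.\<close>

definition frac_int :: "real \<Rightarrow> (real \<Rightarrow> real) \<Rightarrow> real \<Rightarrow> real" where
  "frac_int \<beta> f t = integral {0..t} (\<lambda>u. (t - u) powr (\<beta> - 1) * f u) / Gamma \<beta>"

lemma frac_int_zero [simp]: "frac_int \<beta> f 0 = 0"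
  by (simp add: frac_int_def)

lemma frac_int_cong:
  assumes "\<And>u. u \<in> {0..t} \<Longrightarrow> f u = g u"
  shows "frac_int \<beta> f t = frac_int \<beta> g t"
  unfolding frac_int_def using assms
  by (intro arg_cong2[where f="(/)"] Henstock_Kurzweil_Integration.integral_cong) auto

lemma frac_int_add:
  assumes "0 < \<beta>" "continuous_on {0..t} f" "continuous_on {0..t} g"
  shows "frac_int \<beta> (\<lambda>u. f u + g u) t = frac_int \<beta> f t + frac_int \<beta> g t"
  unfolding frac_int_def using assms
  by (simp add: distrib_left add_divide_distrib Henstock_Kurzweil_Integration.integral_add kernel_mult_integrable)

lemma frac_int_cmult: "frac_int \<beta> (\<lambda>u. c * f u) t = c * frac_int \<beta> f t"
  by (simp add: frac_int_def mult.left_commute[of _ c])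

lemma frac_int_diff:
  assumes "0 < \<beta>" "continuous_on {0..t} f" "continuous_on {0..t} g"
  shows "frac_int \<beta> (\<lambda>u. f u - g u) t = frac_int \<beta> f t - frac_int \<beta> g t"
  using frac_int_add[OF assms(1,2), of "\<lambda>u. - 1 * g u"] frac_int_cmult[of \<beta> "- 1" g t] assms
  by (simp add: continuous_on_minus)

lemma frac_int_sum:
  assumes "0 < \<beta>" "finite I" "\<And>i. i \<in> I \<Longrightarrow> continuous_on {0..t} (f i)"
  shows "frac_int \<beta> (\<lambda>u. \<Sum>i\<in>I. f i u) t = (\<Sum>i\<in>I. frac_int \<beta> (f i) t)"
  using assms(2,3)
proof (induction I rule: finite_induct)
  case empty
  show ?case by (simp add: frac_int_def)
next
  case (insert i I)
  then show ?case
    using frac_int_add[OF assms(1), of t "f i" "\<lambda>u. \<Sum>i\<in>I. f i u"]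
    by (simp add: continuous_on_sum)
qed

lemma frac_int_mono:
  assumes "0 < \<beta>" "continuous_on {0..t} f" "continuous_on {0..t} g"
    and "\<And>u. u \<in> {0..t} \<Longrightarrow> f u \<le> g u"
  shows "frac_int \<beta> f t \<le> frac_int \<beta> g t"
  unfolding frac_int_def using assms
  by (intro divide_right_mono integral_le kernel_mult_integrable mult_left_mono)
    (auto intro: less_imp_le Gamma_real_pos)

lemma frac_int_const:
  assumes "0 < \<beta>" "0 \<le> t"
  shows "frac_int \<beta> (\<lambda>_. c) t = c * t powr \<beta> / Gamma (\<beta> + 1)"
proof -
  have "integral {0..t} (\<lambda>u. (t - u) powr (\<beta> - 1)) = t powr \<beta> / \<beta>"
    using has_integral_power_kernel[OF assms order_refl] assms by (auto dest: integral_unique)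
  moreover have "Gamma (\<beta> + 1) = \<beta> * Gamma \<beta>"
    using assms by (intro Gamma_plus1) (auto elim!: nonpos_Ints_cases)
  ultimately show ?thesis
    by (simp add: frac_int_def)
qed

lemma frac_int_abs_le:
  assumes "0 < \<beta>" "0 \<le> t" "continuous_on {0..t} f"
    and "\<And>u. u \<in> {0..t} \<Longrightarrow> \<bar>f u\<bar> \<le> M"
  shows "\<bar>frac_int \<beta> f t\<bar> \<le> M * t powr \<beta> / Gamma (\<beta> + 1)"
proof -
  have "frac_int \<beta> f t \<le> M * t powr \<beta> / Gamma (\<beta> + 1)"
    using frac_int_mono[of \<beta> t f "\<lambda>_. M"] frac_int_const[of \<beta> t M] assms by fastforce
  moreover have "(- M) * t powr \<beta> / Gamma (\<beta> + 1) \<le> frac_int \<beta> f t"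
    using frac_int_mono[of \<beta> t "\<lambda>_. - M" f] frac_int_const[of \<beta> t "- M"] assms
    by (fastforce simp: abs_le_iff)
  ultimately show ?thesis by (simp add: abs_le_iff)
qed

lemma frac_int_1: "frac_int 1 f t = integral {0..t} f"
proof -
  have "integral {0..t} (\<lambda>u. (t - u) powr (1 - 1) * f u) = integral {0..t} f"
    \<comment> \<open>Since \<open>0 powr 0 = 0\<close>, the two integrands may differ at
      \<open>u = t\<close>, but nowhere else.\<close>
    by (rule integral_spike[of "{t}"]) auto
  then show ?thesis by (simp add: frac_int_def)
qed

lemma frac_int_split:
  assumes "0 < \<beta>" "continuous_on {0..t} f" "0 \<le> s" "s \<le> t"
  shows "frac_int \<beta> f t = (integral {0..s} (\<lambda>u. (t - u) powr (\<beta> - 1) * f u)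
      + integral {s..t} (\<lambda>u. (t - u) powr (\<beta> - 1) * f u)) / Gamma \<beta>"
  unfolding frac_int_def
  by (subst Henstock_Kurzweil_Integration.integral_combine[OF assms(3,4)])
     (use assms in \<open>auto intro: kernel_mult_integrable\<close>)

text \<open>On \<open>{0..s}\<close> the kernel decreases when \<open>s\<close> is replaced by
  \<open>t\<close>, because \<open>\<beta> \<le> 1\<close>; the difference of kernels has constant
  sign and its integral is explicit. The old part and the new part over \<open>{s..t}\<close> each
  contribute at most \<open>M * (t - s) powr \<beta> / \<beta>\<close> before division by
  \<open>Gamma \<beta>\<close>.\<close>

lemma frac_int_hoelder:
  assumes "0 < \<beta>" "\<beta> \<le> 1" "continuous_on {0..t} f" "0 \<le> s" "s \<le> t"
    and M: "\<And>u. u \<in> {0..t} \<Longrightarrow> \<bar>f u\<bar> \<le> M"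
  shows "\<bar>frac_int \<beta> f t - frac_int \<beta> f s\<bar> \<le> 2 * M * (t - s) powr \<beta> / Gamma (\<beta> + 1)"
proof -
  have G: "Gamma (\<beta> + 1) = \<beta> * Gamma \<beta>"
    using assms by (intro Gamma_plus1) (auto elim!: nonpos_Ints_cases)
  have Gpos: "0 < Gamma \<beta>" using assms by (simp add: Gamma_real_pos)
  have M0: "0 \<le> M" using M[of 0] assms by force
  have cs: "continuous_on {0..s} f" "continuous_on {s..t} f"
    using assms by (auto intro: continuous_on_subset)
  have k: "(\<lambda>u. (t - u) powr (\<beta> - 1) * f u) integrable_on {0..s}"
      "(\<lambda>u. (s - u) powr (\<beta> - 1) * f u) integrable_on {0..s}"
      "(\<lambda>u. (t - u) powr (\<beta> - 1) * f u) integrable_on {s..t}"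
    using assms cs by (auto intro!: kernel_mult_integrable)
  have t0: "((\<lambda>u. (t - u) powr (\<beta> - 1)) has_integral (t powr \<beta> - (t - s) powr \<beta>) / \<beta>) {0..s}"
    using has_integral_power_kernel[of \<beta> 0 s t] assms by simp
  have s0: "((\<lambda>u. (s - u) powr (\<beta> - 1)) has_integral s powr \<beta> / \<beta>) {0..s}"
    using has_integral_power_kernel[of \<beta> 0 s s] assms by simp
  have st: "((\<lambda>u. (t - u) powr (\<beta> - 1)) has_integral (t - s) powr \<beta> / \<beta>) {s..t}"
    using has_integral_power_kernel[of \<beta> s t t] assms by simp
  \<comment> \<open>At \<open>u = s\<close> the convention \<open>0 powr (\<beta> - 1) = 0\<close>
    breaks the monotonicity of the kernel, so the majorant is redefined at this single
    point.\<close>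
  define h where "h u = (if u = s then M * (t - s) powr (\<beta> - 1)
      else M * ((s - u) powr (\<beta> - 1) - (t - u) powr (\<beta> - 1)))" for u
  have h: "(h has_integral M * (s powr \<beta> / \<beta> - (t powr \<beta> - (t - s) powr \<beta>) / \<beta>)) {0..s}"
    by (rule has_integral_spike[OF negligible_sing[of s] _ has_integral_mult_right[OF has_integral_diff[OF s0 t0]]])
      (auto simp: h_def)
  have "norm (integral {0..s} (\<lambda>u. (t - u) powr (\<beta> - 1) * f u - (s - u) powr (\<beta> - 1) * f u)) \<le> integral {0..s} h"
  proof (rule Henstock_Kurzweil_Integration.integral_norm_bound_integral)
    show "(\<lambda>u. (t - u) powr (\<beta> - 1) * f u - (s - u) powr (\<beta> - 1) * f u) integrable_on {0..s}"
      by (intro integrable_diff k)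
    show "h integrable_on {0..s}"
      using h by (auto simp: integrable_on_def)
    fix u assume u: "u \<in> {0..s}"
    have fu: "\<bar>f u\<bar> \<le> M" using M[of u] u assms by auto
    show "norm ((t - u) powr (\<beta> - 1) * f u - (s - u) powr (\<beta> - 1) * f u) \<le> h u"
    proof (cases "u = s")
      case True
      then show ?thesis using fu by (simp add: h_def abs_mult mult.commute[of _ "\<bar>f s\<bar>"] mult_right_mono)
    next
      case False
      then have le: "(t - u) powr (\<beta> - 1) \<le> (s - u) powr (\<beta> - 1)"
        using u assms by (intro powr_mono2') auto
      have "norm ((t - u) powr (\<beta> - 1) * f u - (s - u) powr (\<beta> - 1) * f u)
          = \<bar>f u\<bar> * ((s - u) powr (\<beta> - 1) - (t - u) powr (\<beta> - 1))"
        using le by (simp only: left_diff_distrib[symmetric] real_norm_def abs_mult)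
          (simp add: mult.commute)
      also have "\<dots> \<le> M * ((s - u) powr (\<beta> - 1) - (t - u) powr (\<beta> - 1))"
        using le fu by (intro mult_right_mono) auto
      finally show ?thesis using False by (simp add: h_def)
    qed
  qed
  also have "\<dots> = M * (s powr \<beta> / \<beta> - (t powr \<beta> - (t - s) powr \<beta>) / \<beta>)"
    using h by (rule integral_unique)
  also have "\<dots> \<le> M * ((t - s) powr \<beta> / \<beta>)"
  proof -
    have "s powr \<beta> \<le> t powr \<beta>" using assms by (intro powr_mono2) auto
    then show ?thesis using M0 assms
      by (intro mult_left_mono) (auto simp: divide_simps)
  qed
  finally have 1: "\<bar>integral {0..s} (\<lambda>u. (t - u) powr (\<beta> - 1) * f u)
      - integral {0..s} (\<lambda>u. (s - u) powr (\<beta> - 1) * f u)\<bar> \<le> M * ((t - s) powr \<beta> / \<beta>)"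
    using k by (simp add: Henstock_Kurzweil_Integration.integral_diff)
  have "norm (integral {s..t} (\<lambda>u. (t - u) powr (\<beta> - 1) * f u)) \<le> integral {s..t} (\<lambda>u. M * (t - u) powr (\<beta> - 1))"
  proof (rule Henstock_Kurzweil_Integration.integral_norm_bound_integral)
    show "(\<lambda>u. M * (t - u) powr (\<beta> - 1)) integrable_on {s..t}"
      using st by (intro integrable_on_mult_right) (auto simp: integrable_on_def)
    fix u assume "u \<in> {s..t}"
    then show "norm ((t - u) powr (\<beta> - 1) * f u) \<le> M * (t - u) powr (\<beta> - 1)"
      using M[of u] assms by (auto simp: abs_mult mult.commute intro!: mult_right_mono)
  qed (use k in auto)
  also have "\<dots> = M * ((t - s) powr \<beta> / \<beta>)"
    using has_integral_mult_right[OF st, of M] by (rule integral_unique)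
  finally have 2: "\<bar>integral {s..t} (\<lambda>u. (t - u) powr (\<beta> - 1) * f u)\<bar> \<le> M * ((t - s) powr \<beta> / \<beta>)"
    by simp
  have "frac_int \<beta> f t - frac_int \<beta> f s = (integral {0..s} (\<lambda>u. (t - u) powr (\<beta> - 1) * f u)
      - integral {0..s} (\<lambda>u. (s - u) powr (\<beta> - 1) * f u)
      + integral {s..t} (\<lambda>u. (t - u) powr (\<beta> - 1) * f u)) / Gamma \<beta>"
    using frac_int_split[of \<beta> t f s] assms by (simp add: frac_int_def diff_divide_distrib add_divide_distrib)
  also have "\<bar>\<dots>\<bar> \<le> (2 * (M * ((t - s) powr \<beta> / \<beta>))) / Gamma \<beta>"
    unfolding abs_divide using 1 2 Gpos by (simp only: abs_of_pos) (intro divide_right_mono; linarith)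
  also have "\<dots> = 2 * M * (t - s) powr \<beta> / Gamma (\<beta> + 1)"
    by (simp add: G)
  finally show ?thesis .
qed

lemma continuous_on_frac_int:
  assumes "0 < \<beta>" "\<beta> \<le> 1" and f: "continuous_on {0..T} f"
  shows "continuous_on {0..T} (frac_int \<beta> f)"
proof -
  have "bounded (f ` {0..T})"
    by (intro compact_imp_bounded compact_continuous_image f) auto
  then obtain M where M: "\<And>x. x \<in> {0..T} \<Longrightarrow> norm (f x) \<le> M"
    unfolding bounded_iff by blast
  have bound: "\<bar>frac_int \<beta> f s - frac_int \<beta> f t\<bar> \<le> 2 * M * \<bar>s - t\<bar> powr \<beta> / Gamma (\<beta> + 1)"
    if "s \<in> {0..T}" "t \<in> {0..T}" for s t
  proof (cases "s \<le> t")
    case True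
    then show ?thesis
      using frac_int_hoelder[of \<beta> t f s M] assms(1,2) that M continuous_on_subset[OF f, of "{0..t}"]
      by (auto simp: abs_minus_commute)
  next
    case False
    then show ?thesis
      using frac_int_hoelder[of \<beta> s f t M] assms(1,2) that M continuous_on_subset[OF f, of "{0..s}"]
      by (auto simp: abs_minus_commute)
  qed
  show ?thesis
    unfolding continuous_on_def
  proof
    fix t assume t: "t \<in> {0..T}"
    have "((\<lambda>s. 2 * M * \<bar>s - t\<bar> powr \<beta> / Gamma (\<beta> + 1)) \<longlongrightarrow> 2 * M * \<bar>t - t\<bar> powr \<beta> / Gamma (\<beta> + 1)) (at t within {0..T})"
      using assms
      by (intro tendsto_intros tendsto_powr') (auto simp: Gamma_eq_zero_iff elim!: nonpos_Ints_cases)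
    then have *: "((\<lambda>s. 2 * M * \<bar>s - t\<bar> powr \<beta> / Gamma (\<beta> + 1)) \<longlongrightarrow> 0) (at t within {0..T})"
      by simp
    have "\<forall>\<^sub>F s in at t within {0..T}. s \<in> {0..T}"
      by (simp add: eventually_at_filter)
    then have "\<forall>\<^sub>F s in at t within {0..T}.
        norm (frac_int \<beta> f s - frac_int \<beta> f t) \<le> 2 * M * \<bar>s - t\<bar> powr \<beta> / Gamma (\<beta> + 1)"
      by eventually_elim (use bound t in auto)
    then have "((\<lambda>s. frac_int \<beta> f s - frac_int \<beta> f t) \<longlongrightarrow> 0) (at t within {0..T})"
      by (rule Lim_null_comparison[OF _ *])
    then show "(frac_int \<beta> f \<longlongrightarrow> frac_int \<beta> f t) (at t within {0..T})"
      by (rule Lim_null[THEN iffD2])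
  qed
qed

text \<open>Both sides are the triple convolution of \<open>r\<close>, \<open>w\<close> and the
  power kernel. This lets the fractional integral move from one factor to the other in
  \<open>positivity\<close>.\<close>

lemma frac_int_convolution_swap:
  fixes r w :: "real \<Rightarrow> real"
  assumes "0 < \<beta>" "\<beta> \<le> 1" "0 \<le> t" and r: "continuous_on {0..t} r" and w: "continuous_on {0..t} w"
  shows "integral {0..t} (\<lambda>s. r (t - s) * frac_int \<beta> w s) = integral {0..t} (\<lambda>u. frac_int \<beta> r (t - u) * w u)"
proof -
  let ?b = "\<lambda>u::real. u powr (\<beta> - 1)"
  have rev: "continuous_on {0..t} (\<lambda>s. h (t - s))" if "continuous_on {0..t} h" for h :: "real \<Rightarrow> real"
    by (rule continuous_on_compose2[OF that]) (auto intro!: continuous_intros)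
  have Jc: "continuous_on {0..t} (\<lambda>s. integral {0..s} (\<lambda>u. ?b (s - u) * h u))" if "continuous_on {0..t} h" for h :: "real \<Rightarrow> real"
  proof -
    have "continuous_on {0..t} (\<lambda>s. Gamma \<beta> * frac_int \<beta> h s)"
      by (intro continuous_intros continuous_on_frac_int assms that)
    moreover have "Gamma \<beta> \<noteq> 0" using Gamma_real_pos[OF assms(1)] by simp
    ultimately show ?thesis by (simp add: frac_int_def)
  qed
  have "integral {0..t} (\<lambda>s. r (t - s) * integral {0..s} (\<lambda>u. ?b (s - u) * w u))
       = integral {0..t} (\<lambda>u. integral {0..t - u} (\<lambda>v. ?b (t - u - v) * r v) * w u)"
  proof (rule convolution_swap)
    show "set_integrable lborel {0..t} r"
      by (rule borel_integrable_atLeastAtMost'[OF r])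
    show "set_integrable lborel {0..t} ?b" by (rule set_integrable_power[OF assms(1)])
    show "set_integrable lborel {0..t} (\<lambda>s. r (t - s) * integral {0..s} (\<lambda>u. ?b (s - u) * w u))"
      by (intro borel_integrable_atLeastAtMost' continuous_intros Jc[OF w] rev[OF r])
    show "set_integrable lborel {0..t} (\<lambda>u. integral {0..t - u} (\<lambda>v. ?b (t - u - v) * r v) * w u)"
      by (intro borel_integrable_atLeastAtMost' continuous_intros rev[OF Jc[OF r]] w)
    show "set_integrable lborel {0..x} (\<lambda>v. (x - v) powr (\<beta> - 1) * r v)" if "0 < x" "x \<le> t" for x
      using that
      by (intro set_integrable_mult_continuous set_integrable_power_kernel assms continuous_on_subset[OF r]) auto
  qed (use assms in \<open>auto intro: set_integrable_power_kernel\<close>)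
  then have "integral {0..t} (\<lambda>s. r (t - s) * integral {0..s} (\<lambda>u. ?b (s - u) * w u)) / Gamma \<beta>
       = integral {0..t} (\<lambda>u. integral {0..t - u} (\<lambda>v. ?b (t - u - v) * r v) * w u) / Gamma \<beta>"
    by simp
  then show ?thesis
    by (simp add: frac_int_def)
qed

text \<open>After the interchange the inner integral is the Beta integral, and
  \<open>Beta a b\<close> equals \<open>Gamma a * Gamma b / Gamma (a + b)\<close>. The bound
  \<open>b \<le> 1\<close> supplies continuity of the inner fractional integral.\<close>

lemma frac_int_semigroup:
  assumes "0 < a" "0 < b" "b \<le> 1" "0 \<le> t" and c: "continuous_on {0..t} c"
  shows "frac_int a (frac_int b c) t = frac_int (a + b) c t"
proof -
  let ?p = "\<lambda>b u::real. u powr (b - 1)"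
  have inner: "((\<lambda>v. ?p b (x - v) * ?p a v) has_integral Beta a b * ?p (a + b) x) {0..x}" if "0 \<le> x" for x
    using has_integral_beta_kernel[of a b x] assms that by (cases "x = 0") auto
  have G: "Gamma a \<noteq> 0" "Gamma b \<noteq> 0" "Gamma (a + b) \<noteq> 0"
    using assms Gamma_real_pos[of a] Gamma_real_pos[of b] Gamma_real_pos[of "a + b"] by linarith+
  have Jc: "continuous_on {0..t} (\<lambda>s. integral {0..s} (\<lambda>u. ?p b (s - u) * c u))"
  proof -
    have "continuous_on {0..t} (\<lambda>s. Gamma b * frac_int b c s)"
      by (intro continuous_intros continuous_on_frac_int assms)
    then show ?thesis using G by (simp add: frac_int_def)
  qed
  have k: "set_integrable lborel {0..t} (\<lambda>u. ?p (a + b) (t - u) * c u)"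
    using assms by (intro set_integrable_mult_continuous set_integrable_power_kernel c) auto
  have eq: "integral {0..t - u} (\<lambda>v. ?p b (t - u - v) * ?p a v) * c u = Beta a b * (?p (a + b) (t - u) * c u)"
    if "u \<in> {0..t}" for u
    using inner[of "t - u"] that by (simp add: integral_unique)
  have "integral {0..t} (\<lambda>s. ?p a (t - s) * integral {0..s} (\<lambda>u. ?p b (s - u) * c u))
       = integral {0..t} (\<lambda>u. integral {0..t - u} (\<lambda>v. ?p b (t - u - v) * ?p a v) * c u)"
  proof (rule convolution_swap)
    show "set_integrable lborel {0..t} (?p a)" "set_integrable lborel {0..t} (?p b)"
      using assms by (auto intro: set_integrable_power)
    show "set_integrable lborel {0..t} (\<lambda>s. ?p a (t - s) * integral {0..s} (\<lambda>u. ?p b (s - u) * c u))"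
      by (intro set_integrable_mult_continuous set_integrable_power_kernel assms Jc)
    have "set_integrable lborel {0..t} (\<lambda>u. Beta a b * (?p (a + b) (t - u) * c u))"
      using k by (rule set_integrable_mult_right)
    then show "set_integrable lborel {0..t} (\<lambda>u. integral {0..t - u} (\<lambda>v. ?p b (t - u - v) * ?p a v) * c u)"
      by (subst set_integrable_cong[OF refl refl eq])
    show "set_integrable lborel {0..x} (\<lambda>v. ?p b (x - v) * ?p a v)" if "0 < x" "x \<le> t" for x
    proof (rule set_integrable_lborel_if_absolutely_integrable)
      show "(\<lambda>v. ?p b (x - v) * ?p a v) absolutely_integrable_on {0..x}"
        using inner[of x] that by (intro nonnegative_absolutely_integrable_1) (auto simp: integrable_on_def)
    qed auto
  qed (use assms in \<open>auto intro: set_integrable_power_kernel\<close>)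
  also have "\<dots> = integral {0..t} (\<lambda>u. Beta a b * (?p (a + b) (t - u) * c u))"
    by (intro Henstock_Kurzweil_Integration.integral_cong eq)
  also have "\<dots> = Beta a b * (Gamma (a + b) * frac_int (a + b) c t)"
    using G by (simp add: frac_int_def)
  also have "\<dots> = Gamma a * Gamma b * frac_int (a + b) c t"
    using G by (simp add: Beta_def)
  finally show ?thesis
    using G by (simp add: frac_int_def field_simps)
qed

section \<open>Positivity for Volterra equations\<close>

text \<open>Kernel comparisons fail at the right end, where
  \<open>(s - u) powr (\<alpha> - 1)\<close> is 0 instead of singular.\<close>

lemma integral_le_except_right:
  fixes f g :: "real \<Rightarrow> real"
  assumes "f integrable_on {a..b}" "g integrable_on {a..b}"
    and "\<And>x. x \<in> {a..<b} \<Longrightarrow> f x \<le> g x"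
  shows "integral {a..b} f \<le> integral {a..b} g"
proof (rule has_integral_le)
  show "((\<lambda>x. if x = b then g b else f x) has_integral integral {a..b} f) {a..b}"
    by (rule has_integral_spike[OF negligible_sing[of b] _ integrable_integral[OF assms(1)]]) auto
  show "(g has_integral integral {a..b} g) {a..b}"
    by (rule integrable_integral[OF assms(2)])
qed (use assms(3) in auto)

lemma integral_reverse:
  fixes f :: "real \<Rightarrow> real"
  shows "integral {0..t} (\<lambda>u. f (t - u)) = integral {0..t} f"
  using integral_shift_real_ivl[of "- t" "- t" 0 "\<lambda>u. f (- u)"] Henstock_Kurzweil_Integration.integral_reflect_real[of t 0 f]
  by simp

text \<open>\<open>(s / t) powr (1 - \<alpha>)\<close> is the factor by which the kernel
  \<open>t powr (\<alpha> - 1)\<close> decays from time \<open>s\<close> to time \<open>t\<close>.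
  With \<open>x = s - u\<close> and \<open>y = t - u\<close>, \<open>u \<ge> 0\<close>, this says
  that a kernel started later decays at least as fast.\<close>

lemma powr_ratio_le:
  fixes s t x y \<alpha> :: real
  assumes "0 < s" "0 < t" "0 < x" "0 < y" "x * t \<le> y * s" "\<alpha> \<le> 1"
  shows "y powr (\<alpha> - 1) \<le> (s / t) powr (1 - \<alpha>) * x powr (\<alpha> - 1)"
proof -
  have "y powr (\<alpha> - 1) \<le> (t / s * x) powr (\<alpha> - 1)"
    using assms by (intro powr_mono2') (auto simp: field_simps)
  also have "\<dots> = (t / s) powr (\<alpha> - 1) * x powr (\<alpha> - 1)"
    by (rule powr_mult)
  also have "(t / s) powr (\<alpha> - 1) = (s / t) powr (1 - \<alpha>)"
    using assms by (simp add: powr_divide powr_minus_divide[of _ "1 - \<alpha>", simplified])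
  finally show ?thesis .
qed

text \<open>The counterpart for \<open>x = s + c\<close> and \<open>y = t + c\<close> with
  \<open>c \<ge> 0\<close>: a kernel started earlier decays at most as fast. It is the previous
  lemma with the two times interchanged.\<close>

lemma powr_ratio_ge:
  fixes s t x y \<alpha> :: real
  assumes "0 < s" "0 < t" "0 < x" "0 < y" "y * s \<le> x * t" "\<alpha> \<le> 1"
  shows "(s / t) powr (1 - \<alpha>) * x powr (\<alpha> - 1) \<le> y powr (\<alpha> - 1)"
proof -
  have "x powr (\<alpha> - 1) \<le> (t / s) powr (1 - \<alpha>) * y powr (\<alpha> - 1)"
    using powr_ratio_le[of t s y x \<alpha>] assms by simp
  then have "(s / t) powr (1 - \<alpha>) * x powr (\<alpha> - 1)
      \<le> (s / t) powr (1 - \<alpha>) * ((t / s) powr (1 - \<alpha>) * y powr (\<alpha> - 1))"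
    by (intro mult_left_mono) auto
  also have "\<dots> = y powr (\<alpha> - 1)"
    using assms by (simp add: powr_divide)
  finally show ?thesis .
qed

text \<open>The contribution of the history up to \<open>s\<close> decays, between the times
  \<open>s\<close> and \<open>t\<close>, at least by the factor
  \<open>(s / t) powr (1 - \<alpha>)\<close>; the recent part is bounded by its maximum.\<close>

lemma frac_int_le_split:
  assumes "0 < \<alpha>" "\<alpha> \<le> 1" "continuous_on {0..t} f" "0 < s" "s \<le> t"
    and f0: "\<And>u. u \<in> {0..s} \<Longrightarrow> 0 \<le> f u" and fM: "\<And>u. u \<in> {s..t} \<Longrightarrow> f u \<le> M"
  shows "frac_int \<alpha> f t \<le> (s / t) powr (1 - \<alpha>) * frac_int \<alpha> f s + M * (t - s) powr \<alpha> / Gamma (\<alpha> + 1)"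
proof -
  let ?\<rho> = "(s / t) powr (1 - \<alpha>)"
  have G: "Gamma (\<alpha> + 1) = \<alpha> * Gamma \<alpha>"
    using assms by (intro Gamma_plus1) (auto elim!: nonpos_Ints_cases)
  have Gpos: "0 < Gamma \<alpha>" using assms by (simp add: Gamma_real_pos)
  have cs: "continuous_on {0..s} f" "continuous_on {s..t} f"
    using assms by (auto intro: continuous_on_subset)
  have "integral {0..s} (\<lambda>u. (t - u) powr (\<alpha> - 1) * f u)
      \<le> integral {0..s} (\<lambda>u. ?\<rho> * ((s - u) powr (\<alpha> - 1) * f u))"
  proof (rule integral_le_except_right)
    show "(\<lambda>u. (t - u) powr (\<alpha> - 1) * f u) integrable_on {0..s}"
      using assms cs by (intro kernel_mult_integrable) auto
    show "(\<lambda>u. ?\<rho> * ((s - u) powr (\<alpha> - 1) * f u)) integrable_on {0..s}"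
      using assms cs by (intro integrable_on_mult_right kernel_mult_integrable) auto
    fix u assume u: "u \<in> {0..<s}"
    have "u * s \<le> u * t" using u assms by (intro mult_left_mono) auto
    then have "(t - u) powr (\<alpha> - 1) \<le> ?\<rho> * (s - u) powr (\<alpha> - 1)"
      using u assms by (intro powr_ratio_le) (auto simp: algebra_simps)
    from mult_right_mono[OF this f0[of u]] u
    show "(t - u) powr (\<alpha> - 1) * f u \<le> ?\<rho> * ((s - u) powr (\<alpha> - 1) * f u)"
      by (simp add: mult.assoc)
  qed
  also have "\<dots> = ?\<rho> * (Gamma \<alpha> * frac_int \<alpha> f s)"
    using Gpos by (simp add: frac_int_def)
  finally have 1: "integral {0..s} (\<lambda>u. (t - u) powr (\<alpha> - 1) * f u) \<le> ?\<rho> * (Gamma \<alpha> * frac_int \<alpha> f s)" .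
  have st: "((\<lambda>u. M * (t - u) powr (\<alpha> - 1)) has_integral M * ((t - s) powr \<alpha> / \<alpha>)) {s..t}"
    using has_integral_power_kernel[of \<alpha> s t t] assms by (intro has_integral_mult_right) simp
  have 2: "integral {s..t} (\<lambda>u. (t - u) powr (\<alpha> - 1) * f u) \<le> M * ((t - s) powr \<alpha> / \<alpha>)"
  proof (rule has_integral_le[OF integrable_integral st])
    show "(\<lambda>u. (t - u) powr (\<alpha> - 1) * f u) integrable_on {s..t}"
      using assms cs by (intro kernel_mult_integrable) auto
    fix u assume "u \<in> {s..t}"
    then show "(t - u) powr (\<alpha> - 1) * f u \<le> M * (t - u) powr (\<alpha> - 1)"
      using fM[of u] by (simp add: mult.commute[of M] mult_left_mono)
  qed
  have "frac_int \<alpha> f t \<le> (?\<rho> * (Gamma \<alpha> * frac_int \<alpha> f s) + M * ((t - s) powr \<alpha> / \<alpha>)) / Gamma \<alpha>"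
    using frac_int_split[of \<alpha> t f s] assms 1 2 Gpos by (simp add: divide_right_mono)
  also have "\<dots> = ?\<rho> * frac_int \<alpha> f s + M * (t - s) powr \<alpha> / Gamma (\<alpha> + 1)"
    unfolding G using Gpos[THEN less_imp_neq] by (simp add: add_divide_distrib)
  finally show ?thesis .
qed

lemma first_zero:
  fixes d :: "real \<Rightarrow> real"
  assumes d: "continuous_on {0..T} d" and d0: "0 < d 0" and t: "t \<in> {0..T}" "d t \<le> 0"
  obtains t1 where "0 < t1" "t1 \<le> T" "d t1 = 0" "\<And>u. 0 \<le> u \<Longrightarrow> u < t1 \<Longrightarrow> 0 < d u"
proof -
  define S where "S = {0..T} \<inter> d -` {..0}"
  define t1 where "t1 = Inf S"
  have "closed S" unfolding S_def
    by (intro continuous_closed_preimage d) auto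
  moreover have "S \<noteq> {}" "bdd_below S"
    using t by (auto simp: S_def)
  ultimately have "t1 \<in> S"
    unfolding t1_def by (intro closed_contains_Inf)
  then have t1: "0 \<le> t1" "t1 \<le> T" "d t1 \<le> 0" by (auto simp: S_def)
  have least: "t1 \<le> u" if "0 \<le> u" "u \<le> T" "d u \<le> 0" for u
    unfolding t1_def using that \<open>bdd_below S\<close> by (intro cInf_lower) (auto simp: S_def)
  have "\<exists>u. 0 \<le> u \<and> u \<le> t1 \<and> d u = 0"
    using t1 d0 by (intro IVT2' continuous_on_subset[OF d]) auto
  then obtain u where u: "0 \<le> u" "u \<le> t1" "d u = 0" by blast
  then have "u = t1" using least[of u] t1 by auto
  show thesis
  proof
    show "0 < t1" using t1 d0 by (cases "t1 = 0") auto
    show "t1 \<le> T" by (rule t1)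
    show "d t1 = 0" using u \<open>u = t1\<close> by simp
    show "0 < d v" if "0 \<le> v" "v < t1" for v
      using least[of v] that t1 by (meson le_less_trans not_le order_trans less_imp_le)
  qed
qed

text \<open>At a first zero \<open>t1\<close>, compare with a slightly earlier time
  \<open>s\<close>. The forcing keeps at least the fraction
  \<open>\<rho> = (s / t1) powr (1 - \<alpha>)\<close> of its value, and the memory term keeps at
  most this fraction, up to a small error. Hence \<open>d t1\<close> is at least
  \<open>\<rho> * d s\<close> minus the error, which is positive.\<close>

lemma volterra_positive:
  assumes \<alpha>: "0 < \<alpha>" "\<alpha> \<le> 1" and K: "0 \<le> K"
    and d: "continuous_on {0..T} d" and d0: "0 < d 0"
    and eq: "\<And>t. t \<in> {0..T} \<Longrightarrow> d t = F t - K * frac_int \<alpha> d t"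
    and F: "\<And>s t. 0 < s \<Longrightarrow> s \<le> t \<Longrightarrow> t \<le> T \<Longrightarrow> (s / t) powr (1 - \<alpha>) * F s \<le> F t"
    and t: "t \<in> {0..T}"
  shows "0 < d t"
proof (rule ccontr)
  assume neg: "\<not> 0 < d t"
  then have "d t \<le> 0" by simp
  with d d0 t obtain t1 where t1: "0 < t1" "t1 \<le> T" "d t1 = 0"
    and before: "\<And>u. 0 \<le> u \<Longrightarrow> u < t1 \<Longrightarrow> 0 < d u"
    by (rule first_zero) blast
  have Gpos: "0 < Gamma (\<alpha> + 1)" using \<alpha> by (simp add: Gamma_real_pos)
  \<comment> \<open>Chosen so that memory over a time span \<open>\<eta>\<close> costs
    \<open>K * \<eta> powr \<alpha> / Gamma (\<alpha> + 1) \<le> 1 / 4\<close>.\<close>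
  define \<eta> where "\<eta> = (Gamma (\<alpha> + 1) / (4 * (K + 1))) powr (1 / \<alpha>)"
  have \<eta>: "\<eta> > 0" "\<eta> powr \<alpha> = Gamma (\<alpha> + 1) / (4 * (K + 1))"
    using Gpos[THEN less_imp_neq] K \<alpha> by (auto simp: \<eta>_def powr_powr)
  define s0 where "s0 = max (t1 / 2) (t1 - \<eta>)"
  have s0: "0 < s0" "s0 < t1" "t1 - \<eta> \<le> s0" "t1 / 2 \<le> s0" using t1 \<eta> by (auto simp: s0_def)
  \<comment> \<open>Taking \<open>s\<close> as a maximum point bounds the error by a multiple of
    \<open>d s\<close> itself. The restriction \<open>s \<ge> t1 / 2\<close> gives
    \<open>\<rho> \<ge> 1 / 2\<close>, so the contradiction rests on
    \<open>1 / 2 > 1 / 4\<close>.\<close>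
  have "\<exists>s\<in>{s0..t1}. \<forall>u\<in>{s0..t1}. d u \<le> d s"
    by (intro continuous_attains_sup continuous_on_subset[OF d]) (use s0 t1 in auto)
  then obtain s where s: "s \<in> {s0..t1}" "\<And>u. u \<in> {s0..t1} \<Longrightarrow> d u \<le> d s" by blast
  have ds: "0 < d s" using before[of s0] s(2)[of s0] s0 by auto
  then have "s \<noteq> t1" using t1 by auto
  then have s': "0 < s" "s < t1" "t1 / 2 \<le> s" "t1 - s \<le> \<eta>" using s s0 by auto
  let ?\<rho> = "(s / t1) powr (1 - \<alpha>)"
  have "(s / t1) powr 1 \<le> ?\<rho>"
    using s' \<alpha> by (intro powr_mono') auto
  moreover have "1 / 2 \<le> s / t1" using s' t1(1) by (simp add: field_simps)
  moreover have "(s / t1) powr 1 = s / t1" using s' by simp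
  ultimately have \<rho>: "1 / 2 \<le> ?\<rho>" by linarith
  have "frac_int \<alpha> d t1 \<le> ?\<rho> * frac_int \<alpha> d s + d s * (t1 - s) powr \<alpha> / Gamma (\<alpha> + 1)"
  proof (rule frac_int_le_split)
    show "continuous_on {0..t1} d" using t1 by (intro continuous_on_subset[OF d]) auto
    show "0 \<le> d u" if "u \<in> {0..s}" for u using before[of u] that s' by auto
    show "d u \<le> d s" if "u \<in> {s..t1}" for u using s(2)[of u] that s by auto
  qed (use \<alpha> s' in auto)
  then have "K * frac_int \<alpha> d t1 \<le> K * (?\<rho> * frac_int \<alpha> d s + d s * (t1 - s) powr \<alpha> / Gamma (\<alpha> + 1))"
    using K by (intro mult_left_mono)
  also have "\<dots> = ?\<rho> * (K * frac_int \<alpha> d s) + d s * (K * (t1 - s) powr \<alpha> / Gamma (\<alpha> + 1))"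
    by (simp add: algebra_simps)
  also have "K * (t1 - s) powr \<alpha> / Gamma (\<alpha> + 1) \<le> K * \<eta> powr \<alpha> / Gamma (\<alpha> + 1)"
    using K s' \<alpha> Gpos by (intro divide_right_mono mult_left_mono powr_mono2) auto
  also have "\<dots> = K / (4 * (K + 1))" using Gpos by (simp add: \<eta>)
  also have "\<dots> \<le> 1 / 4" using K by (simp add: field_simps)
  finally have "K * frac_int \<alpha> d t1 \<le> ?\<rho> * (K * frac_int \<alpha> d s) + d s * (1 / 4)"
    using ds by simp
  moreover have "?\<rho> * F s \<le> F t1" using F s' t1 by auto
  moreover have "d t1 = F t1 - K * frac_int \<alpha> d t1" "d s = F s - K * frac_int \<alpha> d s"
    using eq[of t1] eq[of s] t1 s' by auto
  moreover have "?\<rho> * d s = ?\<rho> * F s - ?\<rho> * (K * frac_int \<alpha> d s)"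
    by (subst calculation(4)) (simp add: algebra_simps)
  moreover have "1 / 2 * d s \<le> ?\<rho> * d s" using \<rho> ds by (intro mult_right_mono) auto
  ultimately show False using t1(3) ds by linarith
qed

section \<open>Qualitative properties of the relaxation equation\<close>

text \<open>Abstracts the function \<open>E\<^sub>\<alpha> (- K t\<^sup>\<alpha>)\<close> to its
  Volterra equation, from which its properties follow without the power series. It is used at two
  rates: \<open>\<mu>\<close> for the comparison function and a large \<open>K\<close> for
  \<open>positivity\<close>.\<close>

locale relaxation =
  fixes \<alpha> K :: real and r :: "real \<Rightarrow> real"
  assumes \<alpha>: "0 < \<alpha>" "\<alpha> \<le> 1" and K: "0 < K"
    and cont: "continuous_on {0..} r"
    and eq: "0 \<le> t \<Longrightarrow> r t = 1 - K * frac_int \<alpha> r t"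
begin

lemma cont_on [simp, intro]: "continuous_on {0..t} r"
  by (rule continuous_on_subset[OF cont]) auto

lemma at_0 [simp]: "r 0 = 1"
  using eq[of 0] by simp

lemma Gamma_pos [simp, intro]: "0 < Gamma (\<alpha> + 1)"
  using \<alpha> by (simp add: Gamma_real_pos)

lemma pos:
  assumes "0 \<le> t"
  shows "0 < r t"
proof (rule volterra_positive[where \<alpha>=\<alpha> and d=r and F="\<lambda>_. 1" and T=t and K=K and t=t])
  fix s t' :: real assume "0 < s" "s \<le> t'"
  then have "(s / t') powr (1 - \<alpha>) \<le> 1"
    using \<alpha> powr_mono2[of "1 - \<alpha>" "s / t'" 1] by simp
  then show "(s / t') powr (1 - \<alpha>) * 1 \<le> 1" by simp
next
  show "r u = 1 - K * frac_int \<alpha> r u" if "u \<in> {0..t}" for u using eq[of u] that by simp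
qed (use \<alpha> K assms in simp_all)

lemma nonneg: "0 \<le> t \<Longrightarrow> 0 \<le> r t"
  using pos[of t] by simp

lemma frac_int_ge:
  assumes "0 \<le> t" "\<And>u. u \<in> {0..t} \<Longrightarrow> c \<le> r u"
  shows "c * t powr \<alpha> / Gamma (\<alpha> + 1) \<le> frac_int \<alpha> r t"
  using frac_int_mono[of \<alpha> t "\<lambda>_. c" r] frac_int_const[of \<alpha> t c] assms \<alpha> by auto

lemma less_1:
  assumes "0 < t"
  shows "r t < 1"
proof -
  have "\<exists>s\<in>{0..t}. \<forall>u\<in>{0..t}. r s \<le> r u"
    by (intro continuous_attains_inf) (use assms in auto)
  then obtain s where s: "s \<in> {0..t}" "\<And>u. u \<in> {0..t} \<Longrightarrow> r s \<le> r u" by blast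
  then have "0 < r s * t powr \<alpha> / Gamma (\<alpha> + 1)" using pos[of s] assms by simp
  also have "\<dots> \<le> frac_int \<alpha> r t" using s assms by (intro frac_int_ge) auto
  finally show ?thesis using eq[of t] assms K by (simp add: zero_less_mult_iff)
qed

lemma le_1: "0 \<le> t \<Longrightarrow> r t \<le> 1"
  using less_1[of t] by (cases "t = 0") auto

text \<open>The increment \<open>r t - r (t + h)\<close> again solves a Volterra equation; its forcing term is a
  mixture of shifted kernels, which decays no faster than the kernel itself because the kernel
  is log-convex.\<close>

lemma strictly_decreasing:
  assumes "0 \<le> t" "0 < h"
  shows "r (t + h) < r t"
proof -
  define F where "F t = K / Gamma \<alpha> * integral {0..h} (\<lambda>u. (t + h - u) powr (\<alpha> - 1) * r u)" for t
  have G: "0 < Gamma \<alpha>" using \<alpha> by (simp add: Gamma_real_pos)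
  have ch: "continuous_on {0..t} (\<lambda>u. r (u + h))" for t
    by (rule continuous_on_compose2[OF cont]) (use assms in \<open>auto intro!: continuous_intros\<close>)
  have "0 < r t - r (t + h)"
  proof (rule volterra_positive[where \<alpha>=\<alpha> and d="\<lambda>u. r u - r (u + h)" and F=F and T=t and K=K and t=t])
    show "continuous_on {0..t} (\<lambda>u. r u - r (u + h))"
      by (intro continuous_intros ch) auto
    show "0 < r 0 - r (0 + h)" using less_1 assms by simp
    show "r x - r (x + h) = F x - K * frac_int \<alpha> (\<lambda>u. r u - r (u + h)) x" if "x \<in> {0..t}" for x
    proof -
      have "integral {h..x + h} (\<lambda>u. (x + h - u) powr (\<alpha> - 1) * r u)
          = integral {0..x} (\<lambda>u. (x - u) powr (\<alpha> - 1) * r (u + h))"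
        using integral_shift_real_ivl[of 0 "- h" "x" "\<lambda>u. (x - u) powr (\<alpha> - 1) * r (u + h)"]
        by (simp add: algebra_simps)
      then have "frac_int \<alpha> r (x + h) = (integral {0..h} (\<lambda>u. (x + h - u) powr (\<alpha> - 1) * r u)
          + integral {0..x} (\<lambda>u. (x - u) powr (\<alpha> - 1) * r (u + h))) / Gamma \<alpha>"
        using frac_int_split[of \<alpha> "x + h" r h] \<alpha> that assms by auto
      then have "K * frac_int \<alpha> r (x + h) = F x + K * frac_int \<alpha> (\<lambda>u. r (u + h)) x"
        by (simp add: frac_int_def F_def add_divide_distrib algebra_simps)
      moreover have "frac_int \<alpha> (\<lambda>u. r u - r (u + h)) x = frac_int \<alpha> r x - frac_int \<alpha> (\<lambda>u. r (u + h)) x"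
        using \<alpha> ch by (intro frac_int_diff) auto
      ultimately show ?thesis
        using eq[of x] eq[of "x + h"] that assms by (simp add: right_diff_distrib)
    qed
    fix s x :: real assume sx: "0 < s" "s \<le> x"
    have "integral {0..h} (\<lambda>u. (s / x) powr (1 - \<alpha>) * ((s + h - u) powr (\<alpha> - 1) * r u))
        \<le> integral {0..h} (\<lambda>u. (x + h - u) powr (\<alpha> - 1) * r u)"
    proof (rule integral_le)
      fix u assume u: "u \<in> {0..h}"
      have "(h - u) * s \<le> (h - u) * x" using u sx by (intro mult_left_mono) auto
      then have "(s / x) powr (1 - \<alpha>) * (s + h - u) powr (\<alpha> - 1) \<le> (x + h - u) powr (\<alpha> - 1)"
        using u sx \<alpha> by (intro powr_ratio_ge) (auto simp: algebra_simps)
      from mult_right_mono[OF this less_imp_le[OF pos]] u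
      show "(s / x) powr (1 - \<alpha>) * ((s + h - u) powr (\<alpha> - 1) * r u) \<le> (x + h - u) powr (\<alpha> - 1) * r u"
        by (simp add: mult.assoc)
    qed (use \<alpha> sx in \<open>auto intro!: integrable_on_mult_right kernel_mult_integrable\<close>)
    then have "K / Gamma \<alpha> * ((s / x) powr (1 - \<alpha>) * integral {0..h} (\<lambda>u. (s + h - u) powr (\<alpha> - 1) * r u)) \<le> F x"
      unfolding F_def using K G by (intro mult_left_mono) auto
    then show "(s / x) powr (1 - \<alpha>) * F s \<le> F x"
      by (simp add: F_def mult.left_commute)
  qed (use \<alpha> K assms in auto)
  then show ?thesis by simp
qed

lemma antimono: "0 \<le> s \<Longrightarrow> s \<le> t \<Longrightarrow> r t \<le> r s"
  using strictly_decreasing[of s "t - s"] by (cases "s = t") auto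

text \<open>By monotonicity the fractional integral of \<open>r\<close> is at least that of the
  constant \<open>r t\<close>, while positivity of \<open>r\<close> in the Volterra equation bounds
  \<open>K * frac_int \<alpha> r t\<close> by 1.\<close>

lemma le_power:
  assumes "0 < t"
  shows "r t \<le> Gamma (\<alpha> + 1) / K * t powr (- \<alpha>)"
proof -
  have "r t * t powr \<alpha> / Gamma (\<alpha> + 1) \<le> frac_int \<alpha> r t"
    using assms by (intro frac_int_ge) (auto intro: antimono)
  then have "K * (r t * t powr \<alpha> / Gamma (\<alpha> + 1)) \<le> K * frac_int \<alpha> r t"
    using K by (intro mult_left_mono) auto
  also have "\<dots> \<le> 1" using eq[of t] pos[of t] assms by linarith
  finally have "(K * t powr \<alpha>) * r t / Gamma (\<alpha> + 1) \<le> 1"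
    by (simp only: mult_ac times_divide_eq_right)
  then have "(K * t powr \<alpha>) * r t \<le> Gamma (\<alpha> + 1)"
    using Gamma_pos by (simp only: pos_divide_le_eq mult_1_left)
  then have "r t \<le> Gamma (\<alpha> + 1) / (K * t powr \<alpha>)"
    using assms K by (subst pos_le_divide_eq) (auto simp only: mult_ac intro!: mult_pos_pos powr_gt_zero[THEN iffD2])
  also have "\<dots> = Gamma (\<alpha> + 1) / K * t powr (- \<alpha>)"
    by (simp only: powr_minus divide_inverse inverse_mult_distrib mult.assoc)
  finally show ?thesis .
qed

lemma tendsto_0: "(r \<longlongrightarrow> 0) at_top"
proof (rule Lim_null_comparison)
  show "((\<lambda>t. Gamma (\<alpha> + 1) / K * t powr (- \<alpha>)) \<longlongrightarrow> 0) at_top"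
    by (intro tendsto_mult_right_zero tendsto_neg_powr filterlim_ident) (use \<alpha> in simp)
  show "\<forall>\<^sub>F t in at_top. norm (r t) \<le> Gamma (\<alpha> + 1) / K * t powr (- \<alpha>)"
    using eventually_gt_at_top[of 0]
  proof eventually_elim
    case (elim t)
    then show ?case using le_power[of t] nonneg[of t] by (simp only: real_norm_def abs_of_nonneg less_imp_le)
  qed
qed

text \<open>The drop \<open>r s - r t\<close> is \<open>K\<close> times the increment of the
  fractional integral. In that increment the old part does not grow, and the part over
  \<open>{s..t}\<close> is bounded through \<open>r u \<le> r s\<close>.\<close>

lemma delay_bound:
  assumes "0 \<le> s" "s \<le> t"
  shows "r s * (1 - K * (t - s) powr \<alpha> / Gamma (\<alpha> + 1)) \<le> r t"
proof -
  have "frac_int \<alpha> r t \<le> frac_int \<alpha> r s + r s * (t - s) powr \<alpha> / Gamma (\<alpha> + 1)"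
  proof (cases "s = 0")
    case True
    then show ?thesis
      using frac_int_mono[of \<alpha> t r "\<lambda>_. 1"] frac_int_const[of \<alpha> t 1] assms \<alpha> le_1 by simp
  next
    case False
    have "frac_int \<alpha> r t \<le> (s / t) powr (1 - \<alpha>) * frac_int \<alpha> r s + r s * (t - s) powr \<alpha> / Gamma (\<alpha> + 1)"
      using assms \<alpha> False by (intro frac_int_le_split) (auto intro: nonneg antimono)
    moreover have "(s / t) powr (1 - \<alpha>) * frac_int \<alpha> r s \<le> 1 * frac_int \<alpha> r s"
    proof (rule mult_right_mono)
      show "(s / t) powr (1 - \<alpha>) \<le> 1"
        using \<alpha> powr_mono2[of "1 - \<alpha>" "s / t" 1] assms False by simp
      show "0 \<le> frac_int \<alpha> r s"
        using frac_int_ge[of s 0] assms nonneg by simp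
    qed
    ultimately show ?thesis by simp
  qed
  then have "K * frac_int \<alpha> r t \<le> K * (frac_int \<alpha> r s + r s * (t - s) powr \<alpha> / Gamma (\<alpha> + 1))"
    using K by (intro mult_left_mono) auto
  then have "K * frac_int \<alpha> r t - K * frac_int \<alpha> r s \<le> K * (r s * (t - s) powr \<alpha> / Gamma (\<alpha> + 1))"
    by (simp add: distrib_left)
  then have "r s - r t \<le> K * (r s * (t - s) powr \<alpha> / Gamma (\<alpha> + 1))"
    using eq[of s] eq[of t] assms by linarith
  moreover have "r s * (1 - K * (t - s) powr \<alpha> / Gamma (\<alpha> + 1))
      = r s - K * (r s * (t - s) powr \<alpha> / Gamma (\<alpha> + 1))"
    by (simp add: right_diff_distrib mult.left_commute)
  ultimately show ?thesis by linarith
qed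

text \<open>Convolving the equation for \<open>w\<close> with \<open>r\<close> gives
  \<open>K \<integral>\<^sub>0\<^sup>t w = K w0 \<integral>\<^sub>0\<^sup>t r + \<integral>\<^sub>0\<^sup>t (1 - r (t - u)) f u du\<close>, and the last term is
  nondecreasing in \<open>t\<close>.\<close>

lemma positivity:
  assumes T: "0 < T" and w: "continuous_on {0..T} w" and f: "continuous_on {0..T} f"
    and f0: "\<And>t. t \<in> {0..T} \<Longrightarrow> 0 \<le> f t" and w0: "0 < w0"
    and weq: "\<And>t. t \<in> {0..T} \<Longrightarrow> w t = w0 + frac_int \<alpha> (\<lambda>u. f u - K * w u) t"
  shows "0 < w T"
proof (rule ccontr)
  assume "\<not> 0 < w T"
  \<comment> \<open>\<open>w0 * r\<close> solves the equation with \<open>f = 0\<close>, so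
    \<open>e\<close> is the response to \<open>f\<close> from initial value 0. Positivity of
    \<open>r\<close> turns \<open>w T \<le> 0\<close> into the strict
    \<open>e T < 0\<close>.\<close>
  define e where "e u = w u - w0 * r u" for u
  have ec: "continuous_on {0..T} e" unfolding e_def by (intro continuous_intros w) auto
  have eT: "e T < 0" using \<open>\<not> 0 < w T\<close> mult_pos_pos[OF w0 pos[of T]] T by (simp add: e_def)
  define G where "G t = integral {0..t} (\<lambda>u. (1 - r (t - u)) * f u)" for t
  have rev: "continuous_on {0..t} (\<lambda>s. h (t - s))" if "continuous_on {0..t} h" for h :: "real \<Rightarrow> real" and t
    by (rule continuous_on_compose2[OF that]) (auto intro!: continuous_intros)
  have key: "K * integral {0..t} e = G t" if t: "t \<in> {0..T}" for t
  proof -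
    have wt: "continuous_on {0..t} w" and ft: "continuous_on {0..t} f"
      using t by (auto intro: continuous_on_subset[OF w] continuous_on_subset[OF f])
    have J: "continuous_on {0..t} (frac_int \<alpha> h)" if "continuous_on {0..t} h" for h
      using \<alpha> that by (intro continuous_on_frac_int)
    have I: "(\<lambda>u. h (t - u) * g u) integrable_on {0..t}"
      if "continuous_on {0..t} h" "continuous_on {0..t} g" for h g :: "real \<Rightarrow> real"
      by (intro integrable_continuous_real continuous_on_mult rev that)
    have wK: "w s + K * frac_int \<alpha> w s = w0 + frac_int \<alpha> f s" if s: "s \<in> {0..t}" for s
    proof -
      have "continuous_on {0..s} f" "continuous_on {0..s} w"
        using s by (auto intro: continuous_on_subset[OF ft] continuous_on_subset[OF wt])
      then have "frac_int \<alpha> (\<lambda>u. f u - K * w u) s = frac_int \<alpha> f s - K * frac_int \<alpha> w s"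
        unfolding frac_int_cmult[symmetric] using \<alpha> by (intro frac_int_diff continuous_on_mult_left)
      then show ?thesis using weq[of s] s t by simp
    qed
    have rK: "1 - r s = K * frac_int \<alpha> r s" if "0 \<le> s" for s using eq[OF that] by simp
    \<comment> \<open>Insert \<open>1 = r + K * frac_int \<alpha> r\<close> at \<open>t - u\<close>.
      One swap puts the fractional integral on \<open>w\<close>, where \<open>wK\<close> applies; a
      second swap takes it from \<open>f\<close> back to \<open>r\<close>.\<close>
    have "integral {0..t} w = integral {0..t} (\<lambda>u. r (t - u) * w u + K * (frac_int \<alpha> r (t - u) * w u))"
    proof (rule Henstock_Kurzweil_Integration.integral_cong)
      fix u assume "u \<in> {0..t}"
      then show "w u = r (t - u) * w u + K * (frac_int \<alpha> r (t - u) * w u)"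
        using rK[of "t - u"] by (simp add: distrib_right[symmetric] mult.assoc[symmetric])
    qed
    also have "\<dots> = integral {0..t} (\<lambda>u. r (t - u) * w u) + K * integral {0..t} (\<lambda>u. frac_int \<alpha> r (t - u) * w u)"
      by (subst Henstock_Kurzweil_Integration.integral_add[OF I[OF cont_on wt]
            integrable_on_mult_right[OF I[OF J[OF cont_on] wt]]]) simp
    also have "integral {0..t} (\<lambda>u. frac_int \<alpha> r (t - u) * w u) = integral {0..t} (\<lambda>u. r (t - u) * frac_int \<alpha> w u)"
      using \<alpha> t wt by (intro frac_int_convolution_swap[symmetric] cont_on) simp_all
    also have "integral {0..t} (\<lambda>u. r (t - u) * w u) + K * integral {0..t} (\<lambda>u. r (t - u) * frac_int \<alpha> w u)
        = integral {0..t} (\<lambda>u. r (t - u) * w u + K * (r (t - u) * frac_int \<alpha> w u))"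
      by (subst Henstock_Kurzweil_Integration.integral_add[OF I[OF cont_on wt]
            integrable_on_mult_right[OF I[OF cont_on J[OF wt]]]]) simp
    also have "\<dots> = integral {0..t} (\<lambda>u. w0 * r (t - u) + r (t - u) * frac_int \<alpha> f u)"
    proof (rule Henstock_Kurzweil_Integration.integral_cong)
      fix u assume "u \<in> {0..t}"
      then have "r (t - u) * (w u + K * frac_int \<alpha> w u) = r (t - u) * (w0 + frac_int \<alpha> f u)"
        using wK by simp
      then show "r (t - u) * w u + K * (r (t - u) * frac_int \<alpha> w u)
          = w0 * r (t - u) + r (t - u) * frac_int \<alpha> f u"
        by (simp add: algebra_simps)
    qed
    also have "\<dots> = integral {0..t} (\<lambda>u. w0 * r (t - u)) + integral {0..t} (\<lambda>u. r (t - u) * frac_int \<alpha> f u)"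
      by (rule Henstock_Kurzweil_Integration.integral_add[OF _ I[OF cont_on J[OF ft]]])
        (intro integrable_continuous_real continuous_on_mult_left rev cont_on)
    also have "integral {0..t} (\<lambda>u. r (t - u) * frac_int \<alpha> f u) = integral {0..t} (\<lambda>u. frac_int \<alpha> r (t - u) * f u)"
      using \<alpha> t ft by (intro frac_int_convolution_swap cont_on) simp_all
    also have "integral {0..t} (\<lambda>u. w0 * r (t - u)) = w0 * integral {0..t} r"
      by (simp add: integral_reverse)
    finally have "K * integral {0..t} w = K * (w0 * integral {0..t} r)
        + integral {0..t} (\<lambda>u. K * (frac_int \<alpha> r (t - u) * f u))"
      by (simp add: distrib_left)
    moreover have "integral {0..t} (\<lambda>u. K * (frac_int \<alpha> r (t - u) * f u)) = G t"
      unfolding G_def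
      by (rule Henstock_Kurzweil_Integration.integral_cong) (simp add: rK mult.assoc[symmetric])
    moreover have "integral {0..t} e = integral {0..t} w - w0 * integral {0..t} r"
      unfolding e_def using wt
      by (subst Henstock_Kurzweil_Integration.integral_diff)
        (auto intro!: integrable_continuous_real continuous_intros)
    ultimately show ?thesis by (simp add: right_diff_distrib)
  qed
  have Gmono: "G s \<le> G T" if s: "s \<in> {0..T}" for s
  proof -
    have c: "continuous_on {0..T} (\<lambda>u. (1 - r (T - u)) * f u)"
      by (intro continuous_intros rev f) auto
    have "G s \<le> integral {0..s} (\<lambda>u. (1 - r (T - u)) * f u)"
      unfolding G_def
    proof (rule integral_le)
      show "(\<lambda>u. (1 - r (s - u)) * f u) integrable_on {0..s}"
        using s by (intro integrable_continuous_real continuous_intros rev continuous_on_subset[OF f]) auto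
      show "(\<lambda>u. (1 - r (T - u)) * f u) integrable_on {0..s}"
        using s by (intro integrable_continuous_real continuous_on_subset[OF c]) auto
      show "(1 - r (s - u)) * f u \<le> (1 - r (T - u)) * f u" if "u \<in> {0..s}" for u
        using antimono[of "s - u" "T - u"] f0[of u] s that by (intro mult_right_mono) auto
    qed
    also have "\<dots> \<le> G T"
      unfolding G_def
    proof (rule integral_subset_le)
      show "(\<lambda>u. (1 - r (T - u)) * f u) integrable_on {0..s}" "(\<lambda>u. (1 - r (T - u)) * f u) integrable_on {0..T}"
        using s by (auto intro!: integrable_continuous_real continuous_on_subset[OF c])
      show "\<forall>u\<in>{0..T}. 0 \<le> (1 - r (T - u)) * f u"
        using le_1 f0 by simp
    qed (use s in auto)
    finally show ?thesis .
  qed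
  \<comment> \<open>If \<open>e\<close> is negative on a final interval \<open>{s..T}\<close>, its
    integral strictly decreases from \<open>s\<close> to \<open>T\<close>, contradicting
    \<open>key\<close> and the monotonicity of \<open>G\<close>.\<close>
  have "\<exists>s\<in>{0..<T}. \<forall>u\<in>{s..T}. e u \<le> e T / 2"
  proof -
    obtain d where d: "0 < d" "\<And>u. u \<in> {0..T} \<Longrightarrow> dist u T < d \<Longrightarrow> dist (e u) (e T) < - e T / 2"
    proof -
      have "T \<in> {0..T}" "0 < - e T / 2" using T eT by auto
      with ec[unfolded continuous_on_iff] that show thesis by blast
    qed
    show ?thesis
    proof (rule bexI[of _ "max 0 (T - d / 2)"], rule ballI)
      fix u assume u: "u \<in> {max 0 (T - d / 2)..T}"
      then have "dist (e u) (e T) < - e T / 2"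
        using \<open>0 < d\<close> by (intro d(2)) (auto simp: dist_real_def)
      then have "\<bar>e u - e T\<bar> < - e T / 2" by (simp only: dist_real_def)
      then show "e u \<le> e T / 2" by linarith
    qed (use d T in auto)
  qed
  then obtain s where s: "s \<in> {0..<T}" "\<And>u. u \<in> {s..T} \<Longrightarrow> e u \<le> e T / 2" by blast
  have eI: "e integrable_on {a..b}" if "0 \<le> a" "b \<le> T" for a b
    by (intro integrable_continuous_real continuous_on_subset[OF ec]) (use that in auto)
  have "integral {s..T} e \<le> integral {s..T} (\<lambda>_. e T / 2)"
    using s by (intro integral_le eI) auto
  also have "\<dots> < 0" using s eT by (simp add: mult_pos_neg)
  finally have "integral {s..T} e < 0" .
  moreover have "integral {0..s} e + integral {s..T} e = integral {0..T} e"
    using s by (intro Henstock_Kurzweil_Integration.integral_combine eI) auto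
  ultimately have "K * integral {0..T} e < K * integral {0..s} e" using K by simp
  then show False using key[of s] key[of T] Gmono[of s] s T by auto
qed

end

section \<open>The Mittag-Leffler function\<close>

text \<open>Keeps only the part of the Gamma integral over \<open>{R..R + 1}\<close>. Since
  \<open>R\<close> is arbitrary, Gamma outgrows every geometric sequence.\<close>

lemma Gamma_ge_power:
  fixes x R :: real
  assumes "1 \<le> x" "0 < R"
  shows "R powr (x - 1) * exp (- (R + 1)) \<le> Gamma x"
proof -
  have G: "((\<lambda>t. t powr (x - 1) / exp t) has_integral Gamma x) {0..}"
    using assms by (intro Gamma_integral_real) auto
  have i: "(\<lambda>t. t powr (x - 1) / exp t) integrable_on {R..R + 1}"
    using assms by (intro integrable_continuous_real continuous_intros) auto
  have "R powr (x - 1) * exp (- (R + 1)) = integral {R..R + 1} (\<lambda>_. R powr (x - 1) * exp (- (R + 1)))"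
    by simp
  also have "\<dots> \<le> integral {R..R + 1} (\<lambda>t. t powr (x - 1) / exp t)"
  proof (rule integral_le[OF _ i])
    fix t assume t: "t \<in> {R..R + 1}"
    have "R powr (x - 1) * exp (- (R + 1)) \<le> t powr (x - 1) * exp (- t)"
      using t assms by (intro mult_mono powr_mono2) auto
    then show "R powr (x - 1) * exp (- (R + 1)) \<le> t powr (x - 1) / exp t"
      by (simp add: exp_minus divide_inverse)
  qed (rule integrable_continuous_real, rule continuous_on_const)
  also have "\<dots> \<le> integral {0..} (\<lambda>t. t powr (x - 1) / exp t)"
    using G i assms by (intro integral_subset_le) (auto simp: integrable_on_def)
  also have "\<dots> = Gamma x" using G by (rule integral_unique)
  finally show ?thesis .
qed

lemma summable_mittag_leffler:
  fixes z :: real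
  assumes "0 < \<alpha>"
  shows "summable (\<lambda>k. z ^ k / Gamma (\<alpha> * real k + 1))"
proof -
  \<comment> \<open>This makes \<open>R powr (\<alpha> * k)\<close> equal to
    \<open>(2 * \<bar>z\<bar> + 1) ^ k\<close>, so the majorant is geometric with ratio below
    \<open>1 / 2\<close>.\<close>
  define R where "R = (2 * \<bar>z\<bar> + 1) powr (1 / \<alpha>)"
  have R: "0 < R" by (simp add: R_def)
  have le: "norm (z ^ k / Gamma (\<alpha> * real k + 1)) \<le> exp (R + 1) * (\<bar>z\<bar> / (2 * \<bar>z\<bar> + 1)) ^ k" for k
  proof -
    have "R powr (\<alpha> * real k) = (2 * \<bar>z\<bar> + 1) ^ k"
      using assms by (simp add: R_def powr_powr powr_realpow)
    then have le: "(2 * \<bar>z\<bar> + 1) ^ k * exp (- (R + 1)) \<le> Gamma (\<alpha> * real k + 1)"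
      using Gamma_ge_power[of "\<alpha> * real k + 1" R] R assms by simp
    have "norm (z ^ k / Gamma (\<alpha> * real k + 1)) = \<bar>z\<bar> ^ k / Gamma (\<alpha> * real k + 1)"
      using assms Gamma_real_pos[of "\<alpha> * real k + 1"] by (simp add: power_abs add_nonneg_pos)
    also have "\<dots> \<le> \<bar>z\<bar> ^ k / ((2 * \<bar>z\<bar> + 1) ^ k * exp (- (R + 1)))"
      by (rule divide_left_mono[OF le]) (auto intro!: mult_pos_pos Gamma_real_pos add_nonneg_pos simp: assms less_imp_le)
    also have "\<dots> = exp (R + 1) * (\<bar>z\<bar> / (2 * \<bar>z\<bar> + 1)) ^ k"
    proof -
      have "inverse (exp (- (R + 1))) = exp (R + 1)" by (simp only: exp_minus inverse_inverse_eq)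
      then show ?thesis by (simp only: power_divide divide_inverse inverse_mult_distrib
          power_mult_distrib power_inverse mult_ac)
    qed
    finally show ?thesis .
  qed
  have "summable (\<lambda>k. exp (R + 1) * (\<bar>z\<bar> / (2 * \<bar>z\<bar> + 1)) ^ k)"
    by (intro summable_mult summable_geometric) (simp add: field_simps)
  then show ?thesis
    by (rule summable_comparison_test'[where N=0]) (rule le)
qed

lemma isCont_mittag_leffler:
  assumes "0 < \<alpha>"
  shows "isCont (mittag_leffler \<alpha>) x"
proof -
  have "isCont (\<lambda>x. \<Sum>k. inverse (Gamma (\<alpha> * real k + 1)) * x ^ k) x"
    by (rule isCont_powser_converges_everywhere)
      (use summable_mittag_leffler[OF assms] in \<open>simp add: divide_inverse mult.commute\<close>)
  moreover have "mittag_leffler \<alpha> = (\<lambda>x. \<Sum>k. inverse (Gamma (\<alpha> * real k + 1)) * x ^ k)"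
    by (simp add: mittag_leffler_def fun_eq_iff divide_inverse mult.commute)
  ultimately show ?thesis by simp
qed

text \<open>Fractional integration shifts the terms of the Mittag-Leffler series by one index; this
  is the Beta integral again.\<close>

lemma frac_int_powr_power:
  assumes "0 < \<alpha>" "0 \<le> t"
  shows "frac_int \<alpha> (\<lambda>u. (u powr \<alpha>) ^ k / Gamma (\<alpha> * real k + 1)) t
    = (t powr \<alpha>) ^ Suc k / Gamma (\<alpha> * real (Suc k) + 1)"
proof (cases "t = 0")
  case False
  then have t: "0 < t" using assms by simp
  have p: "(u powr \<alpha>) ^ k = u powr (\<alpha> * real k)" if "0 < u" for u k
    using that by (simp add: powr_powr powr_realpow[symmetric])
  have "0 < Gamma \<alpha>" "0 < Gamma (\<alpha> * real k + 1)"
    using assms by (intro Gamma_real_pos add_nonneg_pos; simp)+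
  then have G: "Gamma \<alpha> \<noteq> 0" "Gamma (\<alpha> * real k + 1) \<noteq> 0"
    by (metis less_irrefl)+
  have "((\<lambda>v. (t - v) powr (\<alpha> - 1) * v powr (\<alpha> * real k + 1 - 1))
      has_integral Beta (\<alpha> * real k + 1) \<alpha> * t powr (\<alpha> * real k + 1 + \<alpha> - 1)) {0..t}"
    using assms t by (intro has_integral_beta_kernel) (auto simp: add_nonneg_pos)
  then have "((\<lambda>v. (t - v) powr (\<alpha> - 1) * (v powr \<alpha>) ^ k)
      has_integral Beta (\<alpha> * real k + 1) \<alpha> * t powr (\<alpha> * real k + 1 + \<alpha> - 1)) {0..t}"
    \<comment> \<open>For \<open>k = 0\<close> the integrands disagree at \<open>v = 0\<close>:
      \<open>(0 powr \<alpha>) ^ 0 = 1\<close>, but \<open>0 powr 0 = 0\<close>.\<close>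
    by (rule has_integral_spike[OF negligible_sing[of 0], rotated]) (auto simp: p)
  then have "integral {0..t} (\<lambda>v. (t - v) powr (\<alpha> - 1) * (v powr \<alpha>) ^ k)
      = Beta (\<alpha> * real k + 1) \<alpha> * t powr (\<alpha> * real k + 1 + \<alpha> - 1)"
    by (rule integral_unique)
  moreover have "t powr (\<alpha> * real k + 1 + \<alpha> - 1) = (t powr \<alpha>) ^ Suc k"
    using p[OF t, of "Suc k"] by (simp add: algebra_simps)
  ultimately show ?thesis
    using G by (simp add: frac_int_def Beta_def algebra_simps)
qed simp

text \<open>The partial sums are the Picard iterates of the Volterra equation, and they converge
  uniformly on \<open>{0..t}\<close>, so the limit may be taken under the fractional
  integral.\<close>

lemma mittag_leffler_relaxation:
  assumes \<alpha>: "0 < \<alpha>" "\<alpha> \<le> 1" and K: "0 < K"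
  shows "relaxation \<alpha> K (\<lambda>t. mittag_leffler \<alpha> (- K * t powr \<alpha>))"
proof
  let ?r = "\<lambda>t. mittag_leffler \<alpha> (- K * t powr \<alpha>)"
  show cont: "continuous_on {0..} ?r"
  proof (rule continuous_on_compose2[of UNIV "mittag_leffler \<alpha>"])
    show "continuous_on UNIV (mittag_leffler \<alpha>)"
      using isCont_mittag_leffler[OF \<alpha>(1)] by (intro continuous_at_imp_continuous_on) simp
    show "continuous_on {0..} (\<lambda>t. - K * t powr \<alpha>)"
      using \<alpha> by (intro continuous_on_mult_left continuous_on_powr' continuous_on_id continuous_on_const) auto
  qed simp
  fix t :: real assume t: "0 \<le> t"
  define a where "a u k = (- K * u powr \<alpha>) ^ k / Gamma (\<alpha> * real k + 1)" for u k
  define S where "S n u = (\<Sum>k<n. a u k)" for n u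
  have summ: "summable (a u)" for u
    unfolding a_def[abs_def] by (rule summable_mittag_leffler[OF \<alpha>(1)])
  have r: "?r u = suminf (a u)" for u
    by (simp add: mittag_leffler_def a_def[abs_def])
  have a_eq: "a u k = (- K) ^ k * ((u powr \<alpha>) ^ k / Gamma (\<alpha> * real k + 1))" for u k
    by (simp add: a_def power_mult_distrib[symmetric])
  have ca: "continuous_on {0..t} (\<lambda>u. a u k)" for k
    unfolding a_eq divide_inverse
    using \<alpha> by (intro continuous_on_mult_left continuous_on_mult_right continuous_on_power
        continuous_on_powr' continuous_on_id continuous_on_const) auto
  have cS: "continuous_on {0..t} (S n)" for n
    unfolding S_def by (intro continuous_on_sum ca)
  have cr: "continuous_on {0..t} ?r"
    by (rule continuous_on_subset[OF cont]) auto
  have JS: "S (Suc n) t = 1 - K * frac_int \<alpha> (S n) t" for n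
  proof (induction n)
    case 0
    show ?case by (simp add: S_def a_def frac_int_def)
  next
    case (Suc n)
    have "frac_int \<alpha> (S (Suc n)) t = frac_int \<alpha> (S n) t + frac_int \<alpha> (\<lambda>u. a u n) t"
    proof -
      have "S (Suc n) = (\<lambda>u. S n u + a u n)" by (simp add: S_def fun_eq_iff)
      then show ?thesis using \<alpha> by (simp only: frac_int_add[OF \<alpha>(1) cS ca])
    qed
    moreover have "frac_int \<alpha> (\<lambda>u. a u n) t = (- K) ^ n * ((t powr \<alpha>) ^ Suc n / Gamma (\<alpha> * real (Suc n) + 1))"
      unfolding a_eq using frac_int_powr_power[OF \<alpha>(1) t, of n] by (simp only: frac_int_cmult)
    moreover have "S (Suc (Suc n)) t = S (Suc n) t + a t (Suc n)" by (simp add: S_def)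
    moreover have "a t (Suc n) = - K * ((- K) ^ n * ((t powr \<alpha>) ^ Suc n / Gamma (\<alpha> * real (Suc n) + 1)))"
      unfolding a_eq by simp
    ultimately show ?case using Suc by (simp add: distrib_left)
  qed
  \<comment> \<open>A majorant independent of \<open>u\<close>: its tails
    \<open>\<epsilon> n\<close> bound the remainders uniformly on \<open>{0..t}\<close>.\<close>
  define b where "b k = (K * t powr \<alpha>) ^ k / Gamma (\<alpha> * real k + 1)" for k
  have sb: "summable b"
    unfolding b_def[abs_def] by (rule summable_mittag_leffler[OF \<alpha>(1)])
  have ab: "norm (a u k) \<le> b k" if "u \<in> {0..t}" for u k
  proof -
    have "(K * u powr \<alpha>) ^ k \<le> (K * t powr \<alpha>) ^ k"
      using that K \<alpha> by (intro power_mono mult_left_mono powr_mono2) auto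
    moreover have "0 < Gamma (\<alpha> * real k + 1)"
      using \<alpha> by (intro Gamma_real_pos add_nonneg_pos) auto
    ultimately show ?thesis
      using K by (simp add: a_def b_def power_abs abs_mult divide_right_mono)
  qed
  define \<epsilon> where "\<epsilon> n = suminf b - sum b {..<n}" for n
  have tail: "\<bar>?r u - S n u\<bar> \<le> \<epsilon> n" if "u \<in> {0..t}" for u n
  proof -
    have "?r u - S n u = (\<Sum>k. a u (k + n))"
      by (simp only: r S_def suminf_minus_initial_segment[OF summ])
    moreover have "\<epsilon> n = (\<Sum>k. b (k + n))"
      using suminf_minus_initial_segment[OF sb, of n] by (simp add: \<epsilon>_def)
    moreover have "norm (\<Sum>k. a u (k + n)) \<le> (\<Sum>k. b (k + n))"
      using ab[OF that] by (intro norm_suminf_le summable_ignore_initial_segment[OF sb])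
    ultimately show ?thesis by simp
  qed
  have \<epsilon>0: "\<epsilon> \<longlonglongrightarrow> 0"
    unfolding \<epsilon>_def using tendsto_diff[OF tendsto_const[of "suminf b"] summable_LIMSEQ[OF sb]] by simp
  have Jbound: "norm (frac_int \<alpha> (S n) t - frac_int \<alpha> ?r t) \<le> \<epsilon> n * t powr \<alpha> / Gamma (\<alpha> + 1)" for n
  proof -
    have "frac_int \<alpha> ?r t - frac_int \<alpha> (S n) t = frac_int \<alpha> (\<lambda>u. ?r u - S n u) t"
      using \<alpha> cr cS by (simp add: frac_int_diff)
    moreover have "\<bar>frac_int \<alpha> (\<lambda>u. ?r u - S n u) t\<bar> \<le> \<epsilon> n * t powr \<alpha> / Gamma (\<alpha> + 1)"
      using \<alpha> t tail by (intro frac_int_abs_le continuous_on_diff cr cS) auto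
    ultimately show ?thesis by (simp add: abs_minus_commute)
  qed
  have "(\<lambda>n. frac_int \<alpha> (S n) t - frac_int \<alpha> ?r t) \<longlonglongrightarrow> 0"
  proof (rule Lim_null_comparison)
    show "\<forall>\<^sub>F n in sequentially. norm (frac_int \<alpha> (S n) t - frac_int \<alpha> ?r t) \<le> \<epsilon> n * (t powr \<alpha> / Gamma (\<alpha> + 1))"
      using Jbound by simp
    show "(\<lambda>n. \<epsilon> n * (t powr \<alpha> / Gamma (\<alpha> + 1))) \<longlonglongrightarrow> 0"
      by (rule tendsto_mult_left_zero[OF \<epsilon>0])
  qed
  then have "(\<lambda>n. frac_int \<alpha> (S n) t) \<longlonglongrightarrow> frac_int \<alpha> ?r t"
    by (rule LIM_zero_cancel)
  then have "(\<lambda>n. S (Suc n) t) \<longlonglongrightarrow> 1 - K * frac_int \<alpha> ?r t"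
    unfolding JS by (intro tendsto_intros)
  moreover have "(\<lambda>n. S (Suc n) t) \<longlonglongrightarrow> ?r t"
    unfolding r S_def using summable_LIMSEQ[OF summ[of t]] by (rule LIMSEQ_Suc)
  ultimately show "?r t = 1 - K * frac_int \<alpha> ?r t"
    by (rule LIMSEQ_unique[rotated])
qed (use assms in auto)

section \<open>Caputo derivatives and the comparison argument\<close>

lemma integrals_eq_imp_eq:
  fixes f g :: "real \<Rightarrow> real"
  assumes f: "continuous_on {0..T} f" and g: "continuous_on {0..T} g"
    and eq: "\<And>t. t \<in> {0..T} \<Longrightarrow> integral {0..t} f = integral {0..t} g"
    and T: "0 < T"
  shows "f T = g T"
proof -
  have T': "T \<in> {0..T}" using T by simp
  have "((\<lambda>t. integral {0..t} f) has_vector_derivative f T) (at T within {0..T})"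
    by (rule integral_has_vector_derivative[OF f T'])
  moreover have "((\<lambda>t. integral {0..t} f) has_vector_derivative g T) (at T within {0..T})"
    by (rule has_vector_derivative_transform[OF T' eq integral_has_vector_derivative[OF g T']])
  ultimately show ?thesis
    by (rule vector_derivative_unique_within_closed_interval[of 0 T T, unfolded box_real, OF T T'])
qed

text \<open>Applying \<open>I\<^sup>\<alpha>\<close> to \<open>I\<^sup>1\<^sup>-\<^sup>\<alpha> (x - x 0) = I\<^sup>1 v\<close> yields
  \<open>I\<^sup>1 (x - x 0) = I\<^sup>1 (I\<^sup>\<alpha> v)\<close>.\<close>

lemma fractional_ftc:
  fixes x v :: "real \<Rightarrow> real"
  assumes \<alpha>: "0 < \<alpha>" "\<alpha> < 1" and x: "continuous_on {0..} x" and v: "continuous_on {0..} v"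
    and deriv: "\<And>t. 0 < t \<Longrightarrow>
      (frac_int (1 - \<alpha>) (\<lambda>u. x u - x 0) has_vector_derivative v t) (at t)"
    and t: "0 \<le> t"
  shows "x t = x 0 + frac_int \<alpha> v t"
proof (cases "t = 0")
  case False
  define z where "z u = x u - x 0" for u
  have z: "continuous_on {0..s} z" for s
    unfolding z_def by (intro continuous_intros continuous_on_subset[OF x]) auto
  have v': "continuous_on {0..s} v" for s
    by (rule continuous_on_subset[OF v]) auto
  have ftc: "frac_int (1 - \<alpha>) z s = frac_int 1 v s" if "0 \<le> s" for s
  proof -
    have "(v has_integral (frac_int (1 - \<alpha>) z s - frac_int (1 - \<alpha>) z 0)) {0..s}"
    proof (rule fundamental_theorem_of_calculus_interior[OF that])
      show "continuous_on {0..s} (frac_int (1 - \<alpha>) z)"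
        using \<alpha> by (intro continuous_on_frac_int z) auto
      show "(frac_int (1 - \<alpha>) z has_vector_derivative v u) (at u)" if "u \<in> {0<..<s}" for u
        using deriv[of u] that by (simp add: z_def[abs_def])
    qed
    then show ?thesis by (simp add: frac_int_1 integral_unique)
  qed
  have "integral {0..s} z = integral {0..s} (frac_int \<alpha> v)" if s: "s \<in> {0..t}" for s
  proof -
    have s0: "0 \<le> s" using s by simp
    have "integral {0..s} z = frac_int (\<alpha> + (1 - \<alpha>)) z s"
      by (simp add: frac_int_1)
    also have "\<dots> = frac_int \<alpha> (frac_int (1 - \<alpha>) z) s"
      using \<alpha> by (intro frac_int_semigroup[symmetric] z s0) auto
    also have "\<dots> = frac_int \<alpha> (frac_int 1 v) s"
      by (rule frac_int_cong) (use ftc in auto)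
    also have "\<dots> = frac_int (\<alpha> + 1) v s"
      using \<alpha> by (intro frac_int_semigroup v' s0) auto
    also have "\<dots> = frac_int (1 + \<alpha>) v s" by (simp add: add.commute)
    also have "\<dots> = frac_int 1 (frac_int \<alpha> v) s"
      using \<alpha> by (intro frac_int_semigroup[symmetric] v' s0) auto
    finally show ?thesis by (simp add: frac_int_1)
  qed
  then have "z t = frac_int \<alpha> v t"
    using \<alpha> t False
    by (intro integrals_eq_imp_eq[of t z "frac_int \<alpha> v"] z continuous_on_frac_int v') auto
  then show ?thesis by (simp add: z_def)
qed simp

lemma RL_integral_component:
  fixes x :: "real \<Rightarrow> real ^ 'd"
  assumes "0 < \<beta>" and x: "continuous_on {0..} x"
  shows "RL_integral \<beta> x t $ i = frac_int \<beta> (\<lambda>u. x u $ i) t"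
proof -
  have I: "(\<lambda>u. ((t - u) powr (\<beta> - 1)) *\<^sub>R x u) integrable_on {0..t}"
  proof (rule integrable_componentwise_iff[THEN iffD2], rule ballI)
    fix b :: "real ^ 'd" assume "b \<in> Basis"
    then obtain j where b: "b = axis j 1" by (auto simp: Basis_vec_def)
    have "continuous_on {0..t} (\<lambda>u. x u $ j)"
      by (rule continuous_on_component, rule continuous_on_subset[OF x]) simp
    then have "(\<lambda>u. (t - u) powr (\<beta> - 1) * x u $ j) integrable_on {0..t}"
      by (rule kernel_mult_integrable[OF assms(1)]) auto
    then show "(\<lambda>u. (((t - u) powr (\<beta> - 1)) *\<^sub>R x u) \<bullet> b) integrable_on {0..t}"
      by (simp add: b inner_axis)
  qed
  have "integral {0..t} (\<lambda>u. ((t - u) powr (\<beta> - 1)) *\<^sub>R x u) $ i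
      = integral {0..t} (\<lambda>u. (t - u) powr (\<beta> - 1) * x u $ i)"
    using integral_component_eq_cart[OF I, of i]
    by (simp only: vector_scaleR_component real_scaleR_def)
  then show ?thesis
    using assms by (simp add: RL_integral_def frac_int_def)
qed

lemma caputo_imp_volterra:
  fixes x v :: "real \<Rightarrow> real ^ 'd"
  assumes \<alpha>: "0 < \<alpha>" "\<alpha> \<le> 1" and x: "continuous_on {0..} x" and v: "continuous_on {0..} v"
    and caputo: "\<And>t. 0 < t \<Longrightarrow> has_caputo_derivative \<alpha> x (v t) t"
    and t: "0 \<le> t"
  shows "x t $ i = x 0 $ i + frac_int \<alpha> (\<lambda>u. v u $ i) t"
proof -
  have xi: "continuous_on {0..} (\<lambda>u. x u $ i)" and vi: "continuous_on {0..} (\<lambda>u. v u $ i)"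
    using x v by (auto intro: continuous_on_component)
  have deriv: "((\<lambda>s. RL_integral (1 - \<alpha>) (\<lambda>u. x u - x 0) s $ i) has_vector_derivative v s $ i) (at s)"
    if "0 < s" for s
    using bounded_linear.has_vector_derivative[OF bounded_linear_vec_nth
        caputo[OF that, unfolded has_caputo_derivative_def], of i] .
  show ?thesis
  proof (cases "\<alpha> = 1")
    case False
    then have *: "(\<lambda>s. RL_integral (1 - \<alpha>) (\<lambda>u. x u - x 0) s $ i) = frac_int (1 - \<alpha>) (\<lambda>u. x u $ i - x 0 $ i)"
    proof (intro ext)
      have "continuous_on {0..} (\<lambda>u. x u - x 0)" by (intro continuous_on_diff x continuous_on_const)
      then show "RL_integral (1 - \<alpha>) (\<lambda>u. x u - x 0) s $ i = frac_int (1 - \<alpha>) (\<lambda>u. x u $ i - x 0 $ i) s" for s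
        using \<alpha> False by (subst RL_integral_component) auto
    qed
    show ?thesis
    proof (rule fractional_ftc[of \<alpha> "\<lambda>u. x u $ i" "\<lambda>u. v u $ i" t, OF \<alpha>(1) _ xi vi _ t])
      show "\<alpha> < 1" using \<alpha> False by simp
    qed (use deriv[unfolded *] in blast)
  next
    \<comment> \<open>\<open>RL_integral 0\<close> is the identity, so the hypothesis is an ordinary
      derivative and the classical fundamental theorem suffices.\<close>
    case True
    have "((\<lambda>u. v u $ i) has_integral ((x t - x 0) $ i - (x 0 - x 0) $ i)) {0..t}"
    proof (rule fundamental_theorem_of_calculus_interior[OF t])
      show "continuous_on {0..t} (\<lambda>u. (x u - x 0) $ i)"
        by (intro continuous_intros continuous_on_component continuous_on_subset[OF x]) auto
      show "((\<lambda>u. (x u - x 0) $ i) has_vector_derivative v u $ i) (at u)" if "u \<in> {0<..<t}" for u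
        using deriv[of u] that True by (simp add: RL_integral_def)
    qed
    then show ?thesis using True by (simp add: frac_int_1 integral_unique)
  qed
qed

section \<open>Column sums and the sum norm\<close>

lemma max_col_sum_ge: "(\<Sum>i\<in>UNIV. M $ i $ j) \<le> max_col_sum M"
  unfolding max_col_sum_def by (rule Max_ge) auto

lemma norm1_nonneg: "0 \<le> norm1 x"
  by (simp add: norm1_def sum_nonneg)

lemma norm_le_norm1: "norm x \<le> norm1 x"
  unfolding norm1_def by (rule norm_le_l1_cart)

lemma continuous_on_norm1 [continuous_intros]:
  "continuous_on S f \<Longrightarrow> continuous_on S (\<lambda>t. norm1 (f t))"
  unfolding norm1_def by (intro continuous_intros)

text \<open>All entries of \<open>K\<close> times the identity plus \<open>A\<close>, and of
  \<open>B\<close>, are nonnegative, so each term is bounded by its absolute value whatever the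
  weights \<open>s\<close>. Interchanging the two sums then produces column sums.\<close>

lemma metzler_column_estimate:
  fixes A B :: "real ^ 'd ^ 'd" and x y s :: "real ^ 'd"
  assumes A: "metzler A" and B: "nonneg_matrix B"
    and K: "\<And>i. - (A $ i $ i) \<le> K" and s: "\<And>i. \<bar>s $ i\<bar> \<le> 1"
  shows "K * (\<Sum>i\<in>UNIV. s $ i * x $ i) + (\<Sum>i\<in>UNIV. s $ i * (A *v x + B *v y) $ i)
      \<le> (K + max_col_sum A) * norm1 x + max_col_sum B * norm1 y"
proof -
  define C where "C i j = (if i = j then K else 0) + A $ i $ j" for i j
  have C: "0 \<le> C i j" for i j
    using A K[of i] by (auto simp: C_def metzler_def)
  have B': "0 \<le> B $ i $ j" for i j using B by (simp add: nonneg_matrix_def)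
  have sx: "s $ i * (c * a) \<le> c * \<bar>a\<bar>" if "0 \<le> c" for i c a
  proof -
    have "s $ i * a \<le> \<bar>s $ i\<bar> * \<bar>a\<bar>" by (metis abs_ge_self abs_mult)
    also have "\<dots> \<le> 1 * \<bar>a\<bar>" by (intro mult_right_mono s) auto
    finally have "c * (s $ i * a) \<le> c * \<bar>a\<bar>" using that by (intro mult_left_mono) auto
    then show ?thesis by (simp add: mult.left_commute)
  qed
  have Cx: "K * x $ i + (A *v x) $ i = (\<Sum>j\<in>UNIV. C i j * x $ j)" for i
  proof -
    have "C i j * x $ j = (if i = j then K * x $ j else 0) + A $ i $ j * x $ j" for j
      by (simp add: C_def distrib_right)
    then show ?thesis by (simp add: matrix_vector_mult_def sum.distrib)
  qed
  have "K * (\<Sum>i\<in>UNIV. s $ i * x $ i) + (\<Sum>i\<in>UNIV. s $ i * (A *v x + B *v y) $ i)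
      = (\<Sum>i\<in>UNIV. s $ i * (K * x $ i + (A *v x) $ i) + s $ i * (B *v y) $ i)"
    by (simp add: sum_distrib_left sum.distrib[symmetric] algebra_simps)
  also have "\<dots> = (\<Sum>i\<in>UNIV. (\<Sum>j\<in>UNIV. s $ i * (C i j * x $ j)) + (\<Sum>j\<in>UNIV. s $ i * (B $ i $ j * y $ j)))"
    by (simp only: Cx) (simp add: matrix_vector_mult_def sum_distrib_left)
  also have "\<dots> \<le> (\<Sum>i\<in>UNIV. (\<Sum>j\<in>UNIV. C i j * \<bar>x $ j\<bar>) + (\<Sum>j\<in>UNIV. B $ i $ j * \<bar>y $ j\<bar>))"
    by (intro sum_mono add_mono sx C B')
  also have "\<dots> = (\<Sum>j\<in>UNIV. (\<Sum>i\<in>UNIV. C i j) * \<bar>x $ j\<bar>) + (\<Sum>j\<in>UNIV. (\<Sum>i\<in>UNIV. B $ i $ j) * \<bar>y $ j\<bar>)"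
  proof -
    have "(\<Sum>i\<in>UNIV. \<Sum>j\<in>UNIV. M i j * a j) = (\<Sum>j\<in>UNIV. (\<Sum>i\<in>UNIV. M i j) * a j)"
      for M :: "'d \<Rightarrow> 'd \<Rightarrow> real" and a
      by (subst sum.swap) (simp only: sum_distrib_right)
    then show ?thesis by (simp only: sum.distrib)
  qed
  also have "\<dots> \<le> (\<Sum>j\<in>UNIV. (K + max_col_sum A) * \<bar>x $ j\<bar>) + (\<Sum>j\<in>UNIV. max_col_sum B * \<bar>y $ j\<bar>)"
  proof (intro add_mono sum_mono mult_right_mono)
    show "(\<Sum>i\<in>UNIV. C i j) \<le> K + max_col_sum A" for j
      using max_col_sum_ge[of A j] by (simp add: C_def sum.distrib)
  qed (auto intro: max_col_sum_ge)
  finally show ?thesis by (simp add: norm1_def sum_distrib_left)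
qed

text \<open>A column sum only adds nonnegative off-diagonal entries to the diagonal one.
  Consequently \<open>K + max_col_sum A\<close> is nonnegative once \<open>K\<close> dominates the
  negated diagonal, so \<open>norm1\<close> may be replaced by a larger value in the
  estimate.\<close>

lemma metzler_max_col_sum_ge:
  assumes "metzler A"
  shows "A $ i $ i \<le> max_col_sum A"
proof -
  have "A $ i $ i \<le> (\<Sum>k\<in>UNIV. A $ k $ i)"
    using assms by (subst sum.remove[of _ i]) (auto simp: metzler_def intro!: sum_nonneg)
  also have "\<dots> \<le> max_col_sum A" by (rule max_col_sum_ge)
  finally show ?thesis .
qed

section \<open>Comparison of a solution with the relaxation function\<close>

text \<open>\<open>C\<close> bounds the ratio of the comparison function at the delayed time to its
  present value. The column sum conditions then leave a net decay rate of at least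
  \<open>a\<^sub>0 * (1 - p * C)\<close>, which has to cover \<open>\<mu>\<close>.\<close>

lemma solution_norm1_less:
  fixes \<alpha> \<tau> a\<^sub>0 p \<mu> C L :: real
    and A B :: "real \<Rightarrow> real ^ 'd ^ 'd"
    and q :: "real \<Rightarrow> real"
    and \<phi> x :: "real \<Rightarrow> real ^ 'd"
  assumes \<alpha>: "0 < \<alpha>" "\<alpha> \<le> 1" and \<tau>: "0 < \<tau>"
    and contA: "continuous_on {0..} A" and contB: "continuous_on {0..} B"
    and contq: "continuous_on {0..} q" and q: "q \<in> {0..} \<rightarrow> {0..\<tau>}"
    and A: "\<And>t. 0 \<le> t \<Longrightarrow> metzler (A t)" and B: "\<And>t. 0 \<le> t \<Longrightarrow> nonneg_matrix (B t)"
    and p: "0 < p"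
    and mA: "\<And>t. 0 \<le> t \<Longrightarrow> max_col_sum (A t) \<le> - a\<^sub>0"
    and mB: "\<And>t. 0 \<le> t \<Longrightarrow> max_col_sum (B t) \<le> - p * max_col_sum (A t)"
    and \<mu>: "0 < \<mu>" "\<mu> \<le> a\<^sub>0 * (1 - p * C)" and a\<^sub>0: "0 < a\<^sub>0"
    and C: "0 < C" "1 / C \<le> 1 - \<mu> * \<tau> powr \<alpha> / Gamma (\<alpha> + 1)"
    and sol: "is_solution \<alpha> \<tau> A B q \<phi> x"
    and L: "\<And>s. s \<in> {-\<tau>..0} \<Longrightarrow> norm1 (\<phi> s) < L"
    and t: "0 \<le> t"
  shows "norm1 (x t) < L * mittag_leffler \<alpha> (- \<mu> * t powr \<alpha>)"
proof (rule ccontr)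
  define r where "r t = mittag_leffler \<alpha> (- \<mu> * t powr \<alpha>)" for t
  define Y where "Y t = L * r t" for t
  assume "\<not> ?thesis"
  then have neg: "Y t - norm1 (x t) \<le> 0" by (simp add: Y_def r_def)
  interpret R: relaxation \<alpha> \<mu> r
    unfolding r_def using \<alpha> \<mu>(1) by (rule mittag_leffler_relaxation)
  have cx: "continuous_on {-\<tau>..} x" and x\<phi>: "\<And>s. s \<in> {-\<tau>..0} \<Longrightarrow> x s = \<phi> s"
    and caputo: "\<And>s. 0 < s \<Longrightarrow> has_caputo_derivative \<alpha> x (A s *v x s + B s *v x (s - q s)) s"
    using sol by (auto simp: is_solution_def)
  have cx0: "continuous_on {0..} x" by (rule continuous_on_subset[OF cx]) (use \<tau> in auto)
  have qb: "0 \<le> q s" "q s \<le> \<tau>" if "0 \<le> s" for s using q that by (auto simp: Pi_iff)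
  have xL: "norm1 (x s) < L" if "s \<in> {-\<tau>..0}" for s
    using L[OF that] x\<phi>[OF that] by simp
  have Lpos: "0 < L" using xL[of 0] norm1_nonneg[of "x 0"] \<tau> by auto
  have Ypos: "0 < Y s" if "0 \<le> s" for s using Lpos R.pos[OF that] by (simp add: Y_def)
  have cY: "continuous_on {0..s} Y" for s unfolding Y_def by (intro continuous_on_mult_left R.cont_on)
  obtain t1 where t1: "0 < t1" "t1 \<le> t" "Y t1 - norm1 (x t1) = 0"
    and before: "\<And>u. 0 \<le> u \<Longrightarrow> u < t1 \<Longrightarrow> 0 < Y u - norm1 (x u)"
  proof (rule first_zero[of t "\<lambda>u. Y u - norm1 (x u)" t])
    show "continuous_on {0..t} (\<lambda>u. Y u - norm1 (x u))"
      by (intro continuous_on_diff cY continuous_on_norm1 continuous_on_subset[OF cx0]) auto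
    show "0 < Y 0 - norm1 (x 0)" using xL[of 0] \<tau> by (simp add: Y_def)
  qed (use neg t in auto)
  have le: "norm1 (x u) \<le> Y u" if "0 \<le> u" "u \<le> t1" for u
    using before[of u] t1(3) that by (cases "u = t1") auto
  define v where "v s = A s *v x s + B s *v x (s - q s)" for s
  have cv: "continuous_on {0..} v"
  proof -
    have d: "continuous_on {0..} (\<lambda>s. x (s - q s))"
      by (rule continuous_on_compose2[OF cx])
        (use qb in \<open>force intro!: continuous_on_diff continuous_on_id contq\<close>)+
    have mv: "continuous_on {0..} (\<lambda>s. M s *v y s)"
      if "continuous_on {0..} M" "continuous_on {0..} y" for M :: "real \<Rightarrow> real ^ 'd ^ 'd" and y
      unfolding matrix_vector_mult_def
      by (intro continuous_on_vec_lambda continuous_on_sum continuous_on_mult continuous_on_component that)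
    show ?thesis unfolding v_def[abs_def]
      by (intro continuous_on_add mv contA contB cx0 d)
  qed
  have volterra: "x s $ i = x 0 $ i + frac_int \<alpha> (\<lambda>u. v u $ i) s" if "0 \<le> s" for s i
    by (rule caputo_imp_volterra[OF \<alpha> cx0 cv _ that]) (use caputo in \<open>simp add: v_def\<close>)
  define \<sigma> where "\<sigma> = ((\<chi> i. if 0 \<le> x t1 $ i then 1 else - 1) :: real ^ 'd)"
  have \<sigma>: "\<bar>\<sigma> $ i\<bar> \<le> 1" for i by (simp add: \<sigma>_def)
  have \<sigma>x: "(\<Sum>i\<in>UNIV. \<sigma> $ i * x t1 $ i) = norm1 (x t1)"
    unfolding norm1_def by (rule sum.cong) (auto simp: \<sigma>_def)
  have "bounded ((\<lambda>s. \<Sum>i\<in>UNIV. \<bar>A s $ i $ i\<bar>) ` {0..t1})"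
    by (intro compact_imp_bounded compact_continuous_image continuous_on_sum continuous_on_rabs
        continuous_on_component continuous_on_subset[OF contA]) auto
  then obtain K0 where K0: "\<And>s. s \<in> {0..t1} \<Longrightarrow> norm (\<Sum>i\<in>UNIV. \<bar>A s $ i $ i\<bar>) \<le> K0"
    unfolding bounded_iff by blast
  define K where "K = max K0 1"
  have K: "0 < K" by (simp add: K_def)
  have AK: "- (A s $ i $ i) \<le> K" if "s \<in> {0..t1}" for s i
  proof -
    have "\<bar>A s $ i $ i\<bar> \<le> (\<Sum>i\<in>UNIV. \<bar>A s $ i $ i\<bar>)"
      by (rule member_le_sum) auto
    then show ?thesis using K0[OF that] by (simp add: K_def)
  qed
  define w where "w s = Y s - (\<Sum>i\<in>UNIV. \<sigma> $ i * x s $ i)" for s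
  \<comment> \<open>Defined so that \<open>f - K * w = - (\<mu> * Y + \<sigma> \<bullet> v)\<close>,
    which is the integrand in the Volterra equation of \<open>w\<close>.\<close>
  define f where "f s = K * w s - (\<mu> * Y s + (\<Sum>i\<in>UNIV. \<sigma> $ i * v s $ i))" for s
  have cvi: "continuous_on {0..s} (\<lambda>u. \<sigma> $ i * v u $ i)" for s i
    by (intro continuous_on_mult_left continuous_on_component continuous_on_subset[OF cv]) auto
  have cw: "continuous_on {0..s} w" for s
    unfolding w_def
    by (intro continuous_on_diff cY continuous_on_sum continuous_on_mult_left continuous_on_component
        continuous_on_subset[OF cx0]) auto
  have cf: "continuous_on {0..s} f" for s
    unfolding f_def by (intro continuous_on_diff continuous_on_add continuous_on_mult_left continuous_on_sum cw cY cvi)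
  have f0: "0 \<le> f s" if s: "s \<in> {0..t1}" for s
  proof -
    define m where "m = max_col_sum (A s)"
    define nq where "nq = norm1 (x (s - q s))"
    have s0: "0 \<le> s" "s \<le> t1" using s by auto
    have Ys: "0 < Y s" using Ypos s0 by simp
    have Km: "0 \<le> K + m"
      using AK[OF s, of undefined] metzler_max_col_sum_ge[OF A[OF s0(1)], of undefined]
      unfolding m_def by linarith
    have nq: "nq \<le> C * Y s"
    proof -
      \<comment> \<open>Delayed times before 0 are replaced by 0: there the solution is bounded by
        \<open>L = Y 0\<close>, since \<open>r 0 = 1\<close>. The time lag is still at most
        \<open>\<tau>\<close>.\<close>
      define s' where "s' = max 0 (s - q s)"
      have s': "0 \<le> s'" "s' \<le> s" "s - s' \<le> \<tau>" using qb[OF s0(1)] s0 by (auto simp: s'_def)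
      have "nq \<le> Y s'"
      proof (cases "0 \<le> s - q s")
        case True
        then show ?thesis using le[of "s - q s"] qb[OF s0(1)] s0 by (simp add: nq_def s'_def)
      next
        case False
        then have "s' = 0" by (simp add: s'_def)
        moreover have "nq < L" unfolding nq_def using False qb[OF s0(1)] s0 by (intro xL) auto
        ultimately show ?thesis by (simp add: Y_def)
      qed
      have "1 / C \<le> 1 - \<mu> * (s - s') powr \<alpha> / Gamma (\<alpha> + 1)"
      proof -
        have "(s - s') powr \<alpha> \<le> \<tau> powr \<alpha>" using s' \<alpha> by (intro powr_mono2) auto
        then have "\<mu> * (s - s') powr \<alpha> / Gamma (\<alpha> + 1) \<le> \<mu> * \<tau> powr \<alpha> / Gamma (\<alpha> + 1)"
          using \<mu> by (intro divide_right_mono mult_left_mono less_imp_le[OF R.Gamma_pos]) auto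
        then show ?thesis using C by linarith
      qed
      then have "r s' * (1 / C) \<le> r s' * (1 - \<mu> * (s - s') powr \<alpha> / Gamma (\<alpha> + 1))"
        by (intro mult_left_mono R.nonneg s')
      also have "\<dots> \<le> r s" by (rule R.delay_bound[OF s'(1,2)])
      finally have "r s' \<le> C * r s" using C by (simp add: field_simps)
      then have "Y s' \<le> C * Y s" using mult_left_mono[of "r s'" "C * r s" L] Lpos
        by (simp add: Y_def mult.left_commute)
      with \<open>nq \<le> Y s'\<close> show ?thesis by simp
    qed
    have "K * (\<Sum>i\<in>UNIV. \<sigma> $ i * x s $ i) + (\<Sum>i\<in>UNIV. \<sigma> $ i * v s $ i)
        \<le> (K + m) * norm1 (x s) + max_col_sum (B s) * nq"
      unfolding v_def m_def nq_def
      by (rule metzler_column_estimate[OF A[OF s0(1)] B[OF s0(1)] AK[OF s] \<sigma>])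
    also have "\<dots> \<le> (K + m) * Y s + (- p * m) * (C * Y s)"
    proof (rule add_mono)
      show "(K + m) * norm1 (x s) \<le> (K + m) * Y s"
        using le s0 Km by (intro mult_left_mono) auto
      have "m < 0" using mA[OF s0(1)] a\<^sub>0 by (simp add: m_def)
      have "max_col_sum (B s) * nq \<le> (- p * m) * nq"
        using mB[OF s0(1)] norm1_nonneg unfolding m_def nq_def by (intro mult_right_mono)
      also have "\<dots> \<le> (- p * m) * (C * Y s)"
        using nq p \<open>m < 0\<close> by (intro mult_left_mono) (auto simp: mult_nonneg_nonpos)
      finally show "max_col_sum (B s) * nq \<le> (- p * m) * (C * Y s)" .
    qed
    finally have 1: "K * (\<Sum>i\<in>UNIV. \<sigma> $ i * x s $ i) + (\<Sum>i\<in>UNIV. \<sigma> $ i * v s $ i)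
        \<le> (K - (- m) * (1 - p * C)) * Y s" by (simp add: algebra_simps)
    have pC: "0 < 1 - p * C" using \<mu> a\<^sub>0 by (smt (verit) zero_less_mult_pos)
    have "\<mu> \<le> (- m) * (1 - p * C)"
    proof -
      have "a\<^sub>0 * (1 - p * C) \<le> (- m) * (1 - p * C)"
        using mA[OF s0(1)] pC by (intro mult_right_mono) (auto simp: m_def)
      then show ?thesis using \<mu> by linarith
    qed
    then have "(K - (- m) * (1 - p * C)) * Y s \<le> (K - \<mu>) * Y s"
      using Ys by (intro mult_right_mono) auto
    with 1 show ?thesis by (simp add: f_def w_def algebra_simps)
  qed
  have weq: "w s = w 0 + frac_int \<alpha> (\<lambda>u. f u - K * w u) s" if s: "s \<in> {0..t1}" for s
  proof -
    have cs: "continuous_on {0..s} (\<lambda>u. \<Sum>i\<in>UNIV. \<sigma> $ i * v u $ i)"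
      by (intro continuous_on_sum cvi)
    have "frac_int \<alpha> (\<lambda>u. f u - K * w u) s = frac_int \<alpha> (\<lambda>u. - 1 * ((\<mu> * L) * r u + (\<Sum>i\<in>UNIV. \<sigma> $ i * v u $ i))) s"
      by (rule frac_int_cong) (simp add: f_def Y_def)
    also have "\<dots> = - 1 * (frac_int \<alpha> (\<lambda>u. (\<mu> * L) * r u) s + frac_int \<alpha> (\<lambda>u. \<Sum>i\<in>UNIV. \<sigma> $ i * v u $ i) s)"
      by (simp only: frac_int_cmult frac_int_add[OF \<alpha>(1) continuous_on_mult_left[OF R.cont_on] cs])
    also have "\<dots> = - (L * (\<mu> * frac_int \<alpha> r s)) - (\<Sum>i\<in>UNIV. \<sigma> $ i * frac_int \<alpha> (\<lambda>u. v u $ i) s)"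
      by (simp add: frac_int_cmult frac_int_sum[OF \<alpha>(1) finite cvi])
    also have "\<mu> * frac_int \<alpha> r s = 1 - r s" using R.eq[of s] s by simp
    also have "(\<Sum>i\<in>UNIV. \<sigma> $ i * frac_int \<alpha> (\<lambda>u. v u $ i) s)
        = (\<Sum>i\<in>UNIV. \<sigma> $ i * x s $ i) - (\<Sum>i\<in>UNIV. \<sigma> $ i * x 0 $ i)"
      using volterra[of s] s by (simp add: sum_subtractf[symmetric] right_diff_distrib[symmetric])
    finally show ?thesis by (simp add: w_def Y_def right_diff_distrib)
  qed
  have w0: "0 < w 0"
  proof -
    have "(\<Sum>i\<in>UNIV. \<sigma> $ i * x 0 $ i) \<le> norm1 (x 0)"
      unfolding norm1_def
    proof (rule sum_mono)
      fix i
      have "\<sigma> $ i * x 0 $ i \<le> \<bar>\<sigma> $ i\<bar> * \<bar>x 0 $ i\<bar>" by (metis abs_ge_self abs_mult)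
      also have "\<dots> \<le> 1 * \<bar>x 0 $ i\<bar>" by (intro mult_right_mono \<sigma>) auto
      finally show "\<sigma> $ i * x 0 $ i \<le> \<bar>x 0 $ i\<bar>" by simp
    qed
    then show ?thesis using xL[of 0] \<tau> by (simp add: w_def Y_def)
  qed
  interpret RK: relaxation \<alpha> K "\<lambda>t. mittag_leffler \<alpha> (- K * t powr \<alpha>)"
    using \<alpha> K by (rule mittag_leffler_relaxation)
  have "0 < w t1"
    by (rule RK.positivity[OF t1(1) cw cf f0 w0 weq])
  then show False using t1(3) \<sigma>x by (simp add: w_def)
qed

theorem theorem3p3:
  fixes \<alpha> \<tau> a\<^sub>0 p :: real
    and A B :: "real \<Rightarrow> real ^ 'd ^ 'd"
    and q :: "real \<Rightarrow> real"
  assumes "0 < \<alpha>" and "\<alpha> \<le> 1" and "0 < \<tau>"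
    and "continuous_on {0..} A" and "continuous_on {0..} B"
    and "continuous_on {0..} q" and "q \<in> {0..} \<rightarrow> {0..\<tau>}"
    and "\<forall>t\<ge>0. metzler (A t)"
    and "\<forall>t\<ge>0. nonneg_matrix (B t)"
    and "0 < a\<^sub>0" and "0 < p" and "p < 1"
    and "\<forall>t\<ge>0. max_col_sum (A t) \<le> - a\<^sub>0"
    and "\<forall>t\<ge>0. max_col_sum (B t) / max_col_sum (A t) \<ge> - p"
  shows "(\<forall>\<phi> \<Phi>. continuous_on {-\<tau>..0} \<phi> \<and> is_solution \<alpha> \<tau> A B q \<phi> \<Phi>
            \<longrightarrow> (\<Phi> \<longlongrightarrow> 0) at_top)
       \<and> (\<exists>\<mu>>0. \<forall>\<phi> \<Phi>. continuous_on {-\<tau>..0} \<phi> \<and> is_solution \<alpha> \<tau> A B q \<phi> \<Phi>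
            \<longrightarrow> (\<forall>t\<ge>0. norm1 (\<Phi> t)
                   \<le> (SUP s\<in>{-\<tau>..0}. norm1 (\<phi> s)) * mittag_leffler \<alpha> (- \<mu> * t powr \<alpha>)))"
proof -
  \<comment> \<open>\<open>1 / C\<close> is the midpoint of \<open>p\<close> and 1. Thus
    \<open>p * C < 1\<close>, and \<open>1 - 1 / C = (1 - p) / 2\<close> remains for the loss caused
    by the delay; the second entry of the minimum defining \<open>\<mu>\<close> keeps this loss
    within that amount.\<close>
  define C where "C = 2 / (1 + p)"
  define \<mu> where "\<mu> = min (a\<^sub>0 * (1 - p * C)) ((1 - p) / 2 * Gamma (\<alpha> + 1) / \<tau> powr \<alpha>)"
  have C: "0 < C" using assms(11) by (simp add: C_def)
  have pC: "0 < 1 - p * C" using assms(11,12) by (simp add: C_def field_simps)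
  have G: "0 < Gamma (\<alpha> + 1)" using assms(1) by (intro Gamma_real_pos) simp
  have \<tau>\<alpha>: "0 < \<tau> powr \<alpha>" using assms(3) by simp
  have \<mu>: "0 < \<mu>" "\<mu> \<le> a\<^sub>0 * (1 - p * C)"
    using mult_pos_pos[OF assms(10) pC] G \<tau>\<alpha> assms(12) by (auto simp: \<mu>_def intro!: divide_pos_pos mult_pos_pos)
  have C': "1 / C \<le> 1 - \<mu> * \<tau> powr \<alpha> / Gamma (\<alpha> + 1)"
  proof -
    have "\<mu> \<le> (1 - p) / 2 * Gamma (\<alpha> + 1) / \<tau> powr \<alpha>" by (simp add: \<mu>_def)
    then have "\<mu> * \<tau> powr \<alpha> \<le> (1 - p) / 2 * Gamma (\<alpha> + 1)" by (subst (asm) pos_le_divide_eq[OF \<tau>\<alpha>])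
    then have "\<mu> * \<tau> powr \<alpha> / Gamma (\<alpha> + 1) \<le> (1 - p) / 2" by (subst pos_divide_le_eq[OF G])
    moreover have "1 / C = 1 - (1 - p) / 2" by (simp add: C_def field_simps)
    ultimately show ?thesis by linarith
  qed
  \<comment> \<open>The denominator is negative, so clearing it reverses the inequality.\<close>
  have mB: "max_col_sum (B t) \<le> - p * max_col_sum (A t)" if "0 \<le> t" for t
  proof -
    have "max_col_sum (A t) < 0" using assms(10,13) that by force
    then show ?thesis using assms(14) that by (auto simp: neg_le_divide_eq)
  qed
  interpret relaxation \<alpha> \<mu> "\<lambda>t. mittag_leffler \<alpha> (- \<mu> * t powr \<alpha>)"
    using assms(1,2) \<mu>(1) by (rule mittag_leffler_relaxation)
  have bound: "norm1 (\<Phi> t) \<le> (SUP s\<in>{-\<tau>..0}. norm1 (\<phi> s)) * mittag_leffler \<alpha> (- \<mu> * t powr \<alpha>)"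
    if \<phi>: "continuous_on {-\<tau>..0} \<phi>" and sol: "is_solution \<alpha> \<tau> A B q \<phi> \<Phi>" and t: "0 \<le> t" for \<phi> \<Phi> t
  \<comment> \<open>The strict comparison needs room above the initial supremum: take
    \<open>L = ?M + \<epsilon>\<close>. As \<open>?r \<le> 1\<close>, the excess is at most
    \<open>\<epsilon>\<close>.\<close>
  proof (rule field_le_epsilon)
    fix \<epsilon> :: real assume \<epsilon>: "0 < \<epsilon>"
    let ?M = "SUP s\<in>{-\<tau>..0}. norm1 (\<phi> s)"
    let ?r = "mittag_leffler \<alpha> (- \<mu> * t powr \<alpha>)"
    have "bounded ((\<lambda>s. norm1 (\<phi> s)) ` {-\<tau>..0})"
      by (intro compact_imp_bounded compact_continuous_image continuous_on_norm1 \<phi>) auto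
    then have "norm1 (\<phi> s) \<le> ?M" if "s \<in> {-\<tau>..0}" for s
      using that by (intro cSUP_upper bounded_imp_bdd_above)
    then have "norm1 (\<phi> s) < ?M + \<epsilon>" if "s \<in> {-\<tau>..0}" for s
      using that \<epsilon> by force
    then have "norm1 (\<Phi> t) < (?M + \<epsilon>) * ?r"
      using assms(8,9,13)
      by (intro solution_norm1_less[OF assms(1-7) _ _ assms(11) _ mB \<mu> assms(10) C C' sol _ t]) auto
    also have "\<dots> \<le> ?M * ?r + \<epsilon>"
      using mult_left_mono[OF le_1[OF t], of \<epsilon>] \<epsilon> by (simp add: distrib_right)
    finally show "norm1 (\<Phi> t) \<le> ?M * ?r + \<epsilon>" by simp
  qed
  have "(\<Phi> \<longlongrightarrow> 0) at_top"
    if \<phi>: "continuous_on {-\<tau>..0} \<phi>" and sol: "is_solution \<alpha> \<tau> A B q \<phi> \<Phi>" for \<phi> \<Phi>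
  proof (rule Lim_null_comparison)
    show "\<forall>\<^sub>F t in at_top. norm (\<Phi> t) \<le> (SUP s\<in>{-\<tau>..0}. norm1 (\<phi> s)) * mittag_leffler \<alpha> (- \<mu> * t powr \<alpha>)"
      using eventually_ge_at_top[of 0]
      by eventually_elim (rule order_trans[OF norm_le_norm1 bound[OF \<phi> sol]])
    show "((\<lambda>t. (SUP s\<in>{-\<tau>..0}. norm1 (\<phi> s)) * mittag_leffler \<alpha> (- \<mu> * t powr \<alpha>)) \<longlongrightarrow> 0) at_top"
      by (rule tendsto_mult_right_zero[OF tendsto_0])
  qed
  with bound \<mu>(1) show ?thesis by blast
qed

end
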